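(* Let $(X_t)_{t\ge 0}$ be an irreducible, nonexplosive birth--death process on $\mathbb{N}$ with birth rates $\lambda$, death rates $\nu$ and semigroup $(P_t)_{t\ge0}$. Let $\rho:\mathbb{N}\to(0,\infty)$ be increasing, $u_x=\rho(x+1)-\rho(x)>0$, and $d_u(x,y)=|\rho(x)-\rho(y)|$. Assume that the potential $V_u$ is bounded from below. Then for any $t\ge0$, $$\|P_t\|_{\mathrm{Lip}(d_u)\to\mathrm{Lip}(d_u)}=\|P_t\rho\|_{\mathrm{Lip}(d_u)}=\sup_{x\in\mathbb{N}}\mathbb{E}_x\left[\exp\left(-\int_0^tV_u(X_{u,s})\,ds\right)\right].$$ In particular, the contraction inequality $$\|P_t\|_{\mathrm{Lip}(d_u)\to\mathrm{Lip}(d_u)}\le e^{-\sigma t},\qquad t\ge0,$$ is satisfied with the optimal (largest) constant $\sigma=\sigma_u=\inf_{y\in\mathbb{N}}V_u(y)$.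
   Context: $\mathbb{N}=\{0,1,2,\dots\}$. A birth--death process $(X_t)_{t\ge0}$ with birth rates $\lambda_x$ and death rates $\nu_x$ is the continuous-time Markov chain on $\mathbb{N}$ with generator $\mathcal{L}f(x)=\lambda_x\,\partial f(x)+\nu_x\,\partial^* f(x)$, where $\partial f(x)=f(x+1)-f(x)$, $\partial^*f(x)=f(x-1)-f(x)$; its semigroup is $P_tf(x)=\mathbb{E}_x[f(X_t)]$, and $P_t^x$ denotes the law of $X_t$ started at $x$. Irreducible means $\lambda_x>0$ for all $x\in\mathbb{N}$, $\nu_x>0$ for all $x\ge1$ and $\nu_0=0$. Nonexplosive means $\sum_{x\ge1}\left(\frac1{\lambda_x}+\frac{\nu_x}{\lambda_x\lambda_{x-1}}+\cdots+\frac{\nu_x\cdots\nu_1}{\lambda_x\cdots\lambda_1\lambda_0}\right)=\infty$. The $u$-modification $(X_{u,t})_{t\ge0}$ is the (minimal) birth--death process with birth rates $\lambda^u_x=\frac{u_{x+1}}{u_x}\lambda_{x+1}$ and death rates $\nu^u_x=\frac{u_{x-1}}{u_x}\nu_x$ (so $\nu^u_0=0$), with semigroup $P_{u,t}g(x)=\mathbb{E}_x[g(X_{u,t})]$ (quantities being taken equal to $0$ after a possible explosion). The potential is $V_u(x)=\nu_{x+1}-\nu^u_x+\lambda_x-\lambda^u_x$. For a distance $d$ on $\mathbb{N}$, $\|g\|_{\mathrm{Lip}(d)}=\sup_{x\ne y}\frac{|g(x)-g(y)|}{d(x,y)}$, $\mathrm{Lip}(d)$ is the set of $g$ with $\|g\|_{\mathrm{Lip}(d)}<\infty$,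 $\mathrm{Lip}_1(d)=\{g:\|g\|_{\mathrm{Lip}(d)}\le1\}$, and $\|P_t\|_{\mathrm{Lip}(d)\to\mathrm{Lip}(d)}=\sup_{f\in\mathrm{Lip}_1(d)}\|P_tf\|_{\mathrm{Lip}(d)}$. The Wasserstein curvature with respect to $d$ is the largest constant $\sigma$ for which the contraction inequality holds for all $t\ge0$; it is denoted $\sigma_u$ when $d=d_u$. Standing assumptions: $\lambda^u$, $\nu^u$, $V_u$ are $P_{u,t}$-integrable, i.e. $P_{u,t}(\lambda^u+\nu^u+|V_u|)(x)<\infty$ for all $x,t$; and $\sum_{y}d_u(y,x_0)P_t^x(y)<\infty$ for all $x,x_0\in\mathbb{N}$, $t\ge0$. *)

theory Defs
  imports "HOL-Probability.Probability"
begin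

text \<open>
  The birth--death chain is realised by its jump chain and holding times, driven by an i.i.d.
  sequence of pairs (E, U) with E standard exponential, U uniform on [0,1] and E, U independent:
  in state y the chain waits for E / (lam y + nu y), an exponential time of parameter
  lam y + nu y, and then jumps to y + 1 with probability lam y / (lam y + nu y) and to y - 1
  otherwise.  This is the minimal Markov chain with generator
  L f y = lam y * (f (y + 1) - f y) + nu y * (f (y - 1) - f y).
\<close>

definition bd_noise :: "(real \<times> real) stream measure" where
  "bd_noise = stream_space
     (density lborel (\<lambda>e. ennreal (exponential_density 1 e)) \<Otimes>\<^sub>M uniform_measure lborel {0..1})"

primrec bd_jump_chain ::
  "(nat \<Rightarrow> real) \<Rightarrow> (nat \<Rightarrow> real) \<Rightarrow> nat \<Rightarrow> (real \<times> real) stream \<Rightarrow> nat \<Rightarrow> nat" where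
  "bd_jump_chain lam nu x \<omega> 0 = x"
| "bd_jump_chain lam nu x \<omega> (Suc n) =
     (let y = bd_jump_chain lam nu x \<omega> n
      in if snd (\<omega> !! n) < lam y / (lam y + nu y) then y + 1 else y - 1)"

definition bd_jump_time ::
  "(nat \<Rightarrow> real) \<Rightarrow> (nat \<Rightarrow> real) \<Rightarrow> nat \<Rightarrow> (real \<times> real) stream \<Rightarrow> nat \<Rightarrow> real" where
  "bd_jump_time lam nu x \<omega> n =
     (\<Sum>k<n. fst (\<omega> !! k) /
        (lam (bd_jump_chain lam nu x \<omega> k) + nu (bd_jump_chain lam nu x \<omega> k)))"

text \<open>The state at time t of the chain started at x; the value None means that the chain has
  exploded by time t.\<close>

definition bd_process ::
  "(nat \<Rightarrow> real) \<Rightarrow> (nat \<Rightarrow> real) \<Rightarrow> nat \<Rightarrow> real \<Rightarrow> (real \<times> real) stream \<Rightarrow> nat option" where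
  "bd_process lam nu x t \<omega> =
     (if \<exists>n. t < bd_jump_time lam nu x \<omega> (Suc n)
      then Some (bd_jump_chain lam nu x \<omega> (LEAST n. t < bd_jump_time lam nu x \<omega> (Suc n)))
      else None)"

text \<open>Evaluation along the chain, with value 0 after explosion.\<close>

definition eval0 :: "(nat \<Rightarrow> 'b::zero) \<Rightarrow> nat option \<Rightarrow> 'b" where
  "eval0 f z = (case z of None \<Rightarrow> 0 | Some y \<Rightarrow> f y)"

definition bd_prob :: "(nat \<Rightarrow> real) \<Rightarrow> (nat \<Rightarrow> real) \<Rightarrow> real \<Rightarrow> nat \<Rightarrow> nat \<Rightarrow> real" where
  "bd_prob lam nu t x y = measure bd_noise {\<omega> \<in> space bd_noise. bd_process lam nu x t \<omega> = Some y}"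

text \<open>As an operator on real functions this is meaningful for f integrable with respect to the law
  of the chain at time t; \<open>bd_semigroup_nn\<close> is the same expectation for functions with values in
  [0, \<infinity>].\<close>

definition bd_semigroup ::
  "(nat \<Rightarrow> real) \<Rightarrow> (nat \<Rightarrow> real) \<Rightarrow> real \<Rightarrow> (nat \<Rightarrow> real) \<Rightarrow> nat \<Rightarrow> real" where
  "bd_semigroup lam nu t f x = (\<integral>\<omega>. eval0 f (bd_process lam nu x t \<omega>) \<partial>bd_noise)"

definition bd_semigroup_nn ::
  "(nat \<Rightarrow> real) \<Rightarrow> (nat \<Rightarrow> real) \<Rightarrow> real \<Rightarrow> (nat \<Rightarrow> ennreal) \<Rightarrow> nat \<Rightarrow> ennreal" where
  "bd_semigroup_nn lam nu t f x = (\<integral>\<^sup>+\<omega>. eval0 f (bd_process lam nu x t \<omega>) \<partial>bd_noise)"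

text \<open>The expectation of exp (- integral of V along the chain over [0,t]); the exponential
  functional is 0 on the event that the chain has exploded by time t.\<close>

definition feynman_kac ::
  "(nat \<Rightarrow> real) \<Rightarrow> (nat \<Rightarrow> real) \<Rightarrow> (nat \<Rightarrow> real) \<Rightarrow> real \<Rightarrow> nat \<Rightarrow> ennreal" where
  "feynman_kac lam nu V t x =
     (\<integral>\<^sup>+\<omega>. eval0 (\<lambda>_. ennreal (exp (- (LBINT s:{0..t}. eval0 V (bd_process lam nu x s \<omega>)))))
              (bd_process lam nu x t \<omega>) \<partial>bd_noise)"

definition bd_irreducible :: "(nat \<Rightarrow> real) \<Rightarrow> (nat \<Rightarrow> real) \<Rightarrow> bool" where
  "bd_irreducible lam nu \<longleftrightarrow> (\<forall>x. 0 < lam x) \<and> (\<forall>x\<ge>1. 0 < nu x) \<and> nu 0 = 0"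

text \<open>The summand with index j is nu x ... nu (j+1) / (lam x ... lam j).\<close>

definition bd_nonexplosive :: "(nat \<Rightarrow> real) \<Rightarrow> (nat \<Rightarrow> real) \<Rightarrow> bool" where
  "bd_nonexplosive lam nu \<longleftrightarrow>
     (\<Sum>n. let x = n + 1 in ennreal (\<Sum>j\<le>x. (\<Prod>i\<in>{j<..x}. nu i) / (\<Prod>i\<in>{j..x}. lam i))) = \<infinity>"

text \<open>At x = 0 the truncated subtraction is harmless, since nu 0 = 0.\<close>

definition mod_birth :: "(nat \<Rightarrow> real) \<Rightarrow> (nat \<Rightarrow> real) \<Rightarrow> nat \<Rightarrow> real" where
  "mod_birth u lam x = u (x + 1) / u x * lam (x + 1)"

definition mod_death :: "(nat \<Rightarrow> real) \<Rightarrow> (nat \<Rightarrow> real) \<Rightarrow> nat \<Rightarrow> real" where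
  "mod_death u nu x = u (x - 1) / u x * nu x"

definition potential :: "(nat \<Rightarrow> real) \<Rightarrow> (nat \<Rightarrow> real) \<Rightarrow> (nat \<Rightarrow> real) \<Rightarrow> nat \<Rightarrow> real" where
  "potential u lam nu x = nu (x + 1) - mod_death u nu x + lam x - mod_birth u lam x"

definition lip_norm :: "(nat \<Rightarrow> nat \<Rightarrow> real) \<Rightarrow> (nat \<Rightarrow> real) \<Rightarrow> ennreal" where
  "lip_norm d g = (SUP (x, y) \<in> {(x, y). x \<noteq> y}. ennreal (\<bar>g x - g y\<bar> / d x y))"

definition lip_op_norm ::
  "(nat \<Rightarrow> nat \<Rightarrow> real) \<Rightarrow> ((nat \<Rightarrow> real) \<Rightarrow> nat \<Rightarrow> real) \<Rightarrow> ennreal" where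
  "lip_op_norm d T = (SUP f \<in> {f. lip_norm d f \<le> 1}. lip_norm d (T f))"

definition lip_contraction ::
  "(nat \<Rightarrow> real) \<Rightarrow> (nat \<Rightarrow> real) \<Rightarrow> (nat \<Rightarrow> nat \<Rightarrow> real) \<Rightarrow> real \<Rightarrow> bool" where
  "lip_contraction lam nu d \<sigma> \<longleftrightarrow>
     (\<forall>t\<ge>0. lip_op_norm d (bd_semigroup lam nu t) \<le> ennreal (exp (- \<sigma> * t)))"

definition is_wasserstein_curvature ::
  "(nat \<Rightarrow> real) \<Rightarrow> (nat \<Rightarrow> real) \<Rightarrow> (nat \<Rightarrow> nat \<Rightarrow> real) \<Rightarrow> real \<Rightarrow> bool" where
  "is_wasserstein_curvature lam nu d \<sigma> \<longleftrightarrow>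
     lip_contraction lam nu d \<sigma> \<and> (\<forall>\<sigma>'. lip_contraction lam nu d \<sigma>' \<longrightarrow> \<sigma>' \<le> \<sigma>)"

end

theory Submission
  imports Defs
begin

text \<open>
  Write \<open>L\<close> for the generator of the chain and \<open>P t\<close> for its semigroup.  The increments
  \<open>D t x = P t f (x + 1) - P t f x\<close> of a solution of the backward equation \<open>d/dt P t f = L (P t f)\<close> solve
    \<open>D' t x = lam (x + 1) * D t (x + 1) + nu x * D t (x - 1) - (nu (x + 1) + lam x) * D t x\<close>.
  After division by \<open>u\<close> the off-diagonal coefficients of this system are exactly the birth and death
  rates of the u-modification, and the diagonal coefficient is the sum of these rates and of the
  potential.  So \<open>D / u\<close> solves the backward equation of the Feynman--Kac functional of the
  u-modification with potential \<open>V\<close>.  Once uniqueness is settled, this gives the intertwining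
    \<open>P t f (x + 1) - P t f x = u x * E\<^sub>x[(\<partial>f / u) (X\<^sub>u t) * exp (- \<integral> V (X\<^sub>u s) ds)]\<close>
  for increasing \<open>f\<close> (lemma \<open>intertwining\<close>), from which everything follows.  The Lipschitz
  norm of \<open>g\<close> is the supremum of \<open>\<bar>\<partial>g\<bar> / u\<close>.  For \<open>f = rho\<close> the quotient \<open>\<partial>f / u\<close> is 1, whence the
  formula for the norm of \<open>P t rho\<close>.  If \<open>f\<close> is 1-Lipschitz, then \<open>rho + f\<close> and \<open>rho - f\<close> are
  increasing, hence so are their images under \<open>P t\<close>, and \<open>\<bar>\<partial>(P t f)\<bar> \<le> \<partial>(P t rho)\<close>: the operator norm
  is attained at \<open>rho\<close>.  The rate \<open>inf V\<close> can be read off the exponential functional; it is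
  optimal because paths with at most one jump already show that the functional started at \<open>x\<close>
  decays at time 0 at rate at most \<open>V x\<close>.

  The Feynman--Kac backward equation may have many nonnegative solutions, and the expectation is
  the smallest of them (\<open>fk_minimal\<close>).  That \<open>D / u\<close> is this smallest solution is due to the
  nonexplosion of the original chain: Reuter's series provides a function \<open>\<phi>\<close> with \<open>L \<phi> = 1\<close> that
  tends to infinity, and this yields a comparison principle for bounded subsolutions of the
  backward equation of \<open>L\<close> (\<open>comparison_principle\<close>).  If \<open>R\<close> is the difference of \<open>D\<close> and \<open>u\<close> times
  the functional, the partial sums \<open>W x = (\<Sum>y<x. R y)\<close> are bounded, nonnegative and zero at time 0,
  and satisfy \<open>W' = L W - lam 0 * R 0 \<le> L W\<close>.  Hence \<open>W = 0\<close>.  The same principle shows that \<open>P t\<close>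
  preserves the constant 1 and, applied to pairs of states, that it preserves monotonicity.
  The probabilistic input is confined to the decomposition at the first jump, which gives the
  backward equations in integral form (\<open>fk_equation\<close>).
\<close>

section \<open>Decomposition of the chain at its first jump\<close>

definition bd_target :: "(nat \<Rightarrow> real) \<Rightarrow> (nat \<Rightarrow> real) \<Rightarrow> nat \<Rightarrow> real \<Rightarrow> nat" where
  "bd_target a b x v = (if v < a x / (a x + b x) then x + 1 else x - 1)"

lemma bd_jump_chain_Stream:
  "bd_jump_chain a b x (p ## \<omega>) (Suc n) = bd_jump_chain a b (bd_target a b x (snd p)) \<omega> n"
  by (induction n) (simp_all add: bd_target_def Let_def)

lemma bd_jump_time_Stream:
  "bd_jump_time a b x (p ## \<omega>) (Suc n) =
     fst p / (a x + b x) + bd_jump_time a b (bd_target a b x (snd p)) \<omega> n"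
proof -
  have "bd_jump_time a b x (p ## \<omega>) (Suc n) = fst p / (a x + b x) +
     (\<Sum>k<n. fst ((p ## \<omega>) !! Suc k) / (a (bd_jump_chain a b x (p ## \<omega>) (Suc k))
        + b (bd_jump_chain a b x (p ## \<omega>) (Suc k))))"
    unfolding bd_jump_time_def by (subst sum.lessThan_Suc_shift) simp
  then show ?thesis unfolding bd_jump_time_def bd_jump_chain_Stream by simp
qed

text \<open>
  The Markov property in pathwise form: the path after the first jump is the path of a chain
  driven by the shifted noise, because jump chain and jump times restart there and the index of the
  current state decreases by one.
\<close>

lemma bd_process_Stream:
  "bd_process a b x t (p ## \<omega>) =
     (if t < fst p / (a x + b x) then Some x
      else bd_process a b (bd_target a b x (snd p)) (t - fst p / (a x + b x)) \<omega>)"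
proof (cases "t < fst p / (a x + b x)")
  case True
  then have 0: "t < bd_jump_time a b x (p ## \<omega>) (Suc 0)"
    by (simp add: bd_jump_time_Stream bd_jump_time_def)
  then have "(LEAST n. t < bd_jump_time a b x (p ## \<omega>) (Suc n)) = 0"
    by (intro Least_equality) auto
  with True 0 show ?thesis by (auto simp: bd_process_def)
next
  case False
  let ?t = "t - fst p / (a x + b x)" and ?y = "bd_target a b x (snd p)"
  have n0: "\<not> t < bd_jump_time a b x (p ## \<omega>) (Suc 0)"
    using False by (simp add: bd_jump_time_Stream bd_jump_time_def)
  have S: "t < bd_jump_time a b x (p ## \<omega>) (Suc (Suc n)) \<longleftrightarrow> ?t < bd_jump_time a b ?y \<omega> (Suc n)" for n
    unfolding bd_jump_time_Stream[of a b x p \<omega> "Suc n"] by auto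
  show ?thesis
  proof (cases "\<exists>n. ?t < bd_jump_time a b ?y \<omega> (Suc n)")
    case True
    then obtain n where n: "t < bd_jump_time a b x (p ## \<omega>) (Suc (Suc n))" using S by blast
    have "(LEAST n. t < bd_jump_time a b x (p ## \<omega>) (Suc n)) =
       Suc (LEAST n. t < bd_jump_time a b x (p ## \<omega>) (Suc (Suc n)))"
      by (rule Least_Suc[where P = "\<lambda>n. t < bd_jump_time a b x (p ## \<omega>) (Suc n)"]) (fact n n0)+
    with True n False S show ?thesis
      by (auto simp: bd_process_def bd_jump_chain_Stream simp del: bd_jump_chain.simps)
  next
    case F: False
    have "\<not> (\<exists>n. t < bd_jump_time a b x (p ## \<omega>) (Suc n))"
      using F S n0 by (metis not0_implies_Suc)
    with F False show ?thesis by (auto simp: bd_process_def)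
  qed
qed

text \<open>
  Fewer than \<open>n\<close> jumps by time \<open>t\<close>.  The quantifier replaces the comparison with the \<open>n\<close>-th jump
  time alone, since the jump times increase only almost surely.  The event vanishes for \<open>n = 0\<close>
  and exhausts nonexplosion as \<open>n\<close> grows, which lets expectations be computed by recursion on \<open>n\<close>.
\<close>

definition fewer_jumps ::
  "(nat \<Rightarrow> real) \<Rightarrow> (nat \<Rightarrow> real) \<Rightarrow> nat \<Rightarrow> nat \<Rightarrow> real \<Rightarrow> (real \<times> real) stream \<Rightarrow> bool" where
  "fewer_jumps a b n x t \<omega> \<longleftrightarrow> (\<exists>k<n. t < bd_jump_time a b x \<omega> (Suc k))"

lemma fewer_jumps_Stream:
  "fewer_jumps a b (Suc n) x t (p ## \<omega>) \<longleftrightarrow>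
     t < fst p / (a x + b x) \<or> fewer_jumps a b n (bd_target a b x (snd p)) (t - fst p / (a x + b x)) \<omega>"
proof -
  have "fewer_jumps a b (Suc n) x t (p ## \<omega>) \<longleftrightarrow> t < bd_jump_time a b x (p ## \<omega>) (Suc 0) \<or>
     (\<exists>k<n. t < bd_jump_time a b x (p ## \<omega>) (Suc (Suc k)))"
    unfolding fewer_jumps_def by (auto simp: less_Suc_eq_0_disj)
  then show ?thesis
    unfolding bd_jump_time_Stream fewer_jumps_def by (auto simp: bd_jump_time_def algebra_simps)
qed

section \<open>Measurability of the paths\<close>

abbreviation noise1 :: "(real \<times> real) measure" where
  "noise1 \<equiv> density lborel (\<lambda>e. ennreal (exponential_density 1 e)) \<Otimes>\<^sub>M uniform_measure lborel {0..1}"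

lemma prob_space_noise1: "prob_space noise1"
proof -
  interpret A: prob_space "density lborel (\<lambda>e. ennreal (exponential_density 1 e))"
    by (rule prob_space_exponential_density) simp
  interpret B: prob_space "uniform_measure lborel {0..1::real}"
    by (rule prob_space_uniform_measure) auto
  interpret pair_prob_space "density lborel (\<lambda>e. ennreal (exponential_density 1 e))" "uniform_measure lborel
      {0..1::real}" ..
  show ?thesis by (rule prob_space_axioms)
qed

lemma prob_space_bd_noise: "prob_space bd_noise"
  unfolding bd_noise_def by (rule prob_space.prob_space_stream_space[OF prob_space_noise1])

lemma sets_bd_noise[measurable_cong]: "sets bd_noise = sets (stream_space (borel \<Otimes>\<^sub>M borel))"
  unfolding bd_noise_def
  by (intro sets_stream_space_cong sets_pair_measure_cong) auto

lemma measurable_bd_jump_chain[measurable]: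
  "(\<lambda>\<omega>. bd_jump_chain a b x \<omega> n) \<in> measurable bd_noise (count_space UNIV)"
proof (induction n)
  case (Suc n)
  note [measurable] = Suc
  have "(\<lambda>\<omega>. (\<lambda>y \<omega>. if snd (\<omega> !! n) < a y / (a y + b y) then y + 1 else y - 1)
           (bd_jump_chain a b x \<omega> n) \<omega>) \<in> measurable bd_noise (count_space UNIV)"
    by (rule measurable_compose_countable) measurable
  then show ?case by (simp add: Let_def)
qed simp

lemma measurable_bd_jump_time[measurable]:
  "(\<lambda>\<omega>. bd_jump_time a b x \<omega> n) \<in> borel_measurable bd_noise"
proof -
  have [measurable]: "(\<lambda>\<omega>. (\<lambda>y \<omega>. fst (\<omega> !! k) / (a y + b y)) (bd_jump_chain a b x \<omega> k) \<omega>)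
     \<in> borel_measurable bd_noise" for k
    by (rule measurable_compose_countable) measurable
  show ?thesis unfolding bd_jump_time_def by measurable
qed

lemma measurable_bd_process[measurable]:
  "(\<lambda>(t, \<omega>). bd_process a b x t \<omega>) \<in> measurable (borel \<Otimes>\<^sub>M bd_noise) (count_space UNIV)"
proof -
  have [measurable]: "(\<lambda>p. (\<lambda>n p. bd_jump_chain a b x (snd p) n)
       (LEAST n. fst p < bd_jump_time a b x (snd p) (Suc n)) p)
     \<in> measurable (borel \<Otimes>\<^sub>M bd_noise) (count_space UNIV)"
    by (rule measurable_compose_countable) measurable
  show ?thesis unfolding bd_process_def case_prod_beta by measurable
qed

lemma measurable_fewer_jumps[measurable]:
  "Measurable.pred (borel \<Otimes>\<^sub>M bd_noise) (\<lambda>(t, \<omega>). fewer_jumps a b n x t \<omega>)"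
  unfolding fewer_jumps_def case_prod_beta by measurable

lemma measurable_eval0[measurable]: "eval0 f \<in> borel_measurable (count_space UNIV)"
  by simp

text \<open>
  With \<open>V = 0\<close> this is evaluation of \<open>g\<close> along the chain, with \<open>g = 1\<close> the exponential functional;
  both the semigroup and the Feynman--Kac expectation are instances.
\<close>

definition fk_path ::
  "(nat \<Rightarrow> real) \<Rightarrow> (nat \<Rightarrow> real) \<Rightarrow> (nat \<Rightarrow> real) \<Rightarrow> (nat \<Rightarrow> ennreal) \<Rightarrow> nat \<Rightarrow> real \<Rightarrow> (real \<times> real) stream \<Rightarrow> ennreal" where
  "fk_path a b V g x t \<omega> = eval0 g (bd_process a b x t \<omega>) *
     ennreal (exp (- (LBINT s:{0..t}. eval0 V (bd_process a b x s \<omega>))))"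

lemma measurable_fk_path[measurable]:
  "(\<lambda>(t, \<omega>). fk_path a b V g x t \<omega>) \<in> borel_measurable (borel \<Otimes>\<^sub>M bd_noise)"
proof -
  have proc: "(\<lambda>(p, s). bd_process a b x s (snd p))
     \<in> measurable ((borel \<Otimes>\<^sub>M bd_noise) \<Otimes>\<^sub>M lborel) (count_space UNIV)"
    using measurable_compose[of "\<lambda>(p, s). (s, snd p)" "(borel \<Otimes>\<^sub>M bd_noise) \<Otimes>\<^sub>M lborel" "borel \<Otimes>\<^sub>M bd_noise",
       OF _ measurable_bd_process[of a b x]]
    by (simp add: case_prod_beta')
  have e: "(\<lambda>(p, s). eval0 V (bd_process a b x s (snd p))) \<in> borel_measurable ((borel \<Otimes>\<^sub>M bd_noise) \<Otimes>\<^sub>M lborel)"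
    using measurable_compose[OF proc measurable_eval0[of V]] by (simp add: case_prod_beta')
  have i: "(\<lambda>(p, s). indicator {0..fst p} (s :: real) :: real) \<in> borel_measurable ((borel \<Otimes>\<^sub>M bd_noise) \<Otimes>\<^sub>M lborel)"
    unfolding indicator_def atLeastAtMost_iff case_prod_beta' by measurable
  have [measurable]: "(\<lambda>p. LBINT s:{0..fst p}. eval0 V (bd_process a b x s (snd p)))
     \<in> borel_measurable (borel \<Otimes>\<^sub>M bd_noise)"
    unfolding set_lebesgue_integral_def
    using borel_measurable_scaleR[OF i[unfolded case_prod_beta'] e[unfolded case_prod_beta']]
    by (intro lborel.borel_measurable_lebesgue_integral) (simp add: case_prod_beta')
  have [measurable]: "(\<lambda>p. eval0 g (bd_process a b x (fst p) (snd p))) \<in> borel_measurable (borel \<Otimes>\<^sub>M bd_noise)"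
    using measurable_compose[OF measurable_bd_process[of a b x] measurable_eval0[of g]]
    by (simp add: case_prod_beta')
  show ?thesis unfolding fk_path_def case_prod_beta' by measurable
qed

section \<open>Feynman--Kac functionals and their backward equation\<close>

text \<open>
  Before a time at which the chain has not exploded, the path has visited only the finitely many
  states up to the current index of the jump chain; so any function is bounded along it.
\<close>

lemma bd_process_before:
  assumes "bd_process a b x t \<omega> \<noteq> None" "s \<le> t"
  shows "\<exists>n\<le>(LEAST n. t < bd_jump_time a b x \<omega> (Suc n)). bd_process a b x s \<omega> = Some (bd_jump_chain a b x \<omega> n)"
proof -
  define N where "N = (LEAST n. t < bd_jump_time a b x \<omega> (Suc n))"
  have "t < bd_jump_time a b x \<omega> (Suc N)"
    unfolding N_def by (rule LeastI_ex) (use assms(1) in \<open>auto simp: bd_process_def split: if_splits\<close>)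
  with assms(2) have "s < bd_jump_time a b x \<omega> (Suc N)" by simp
  then show ?thesis
    unfolding N_def[symmetric]
    by (intro exI[of _ "LEAST n. s < bd_jump_time a b x \<omega> (Suc n)"])
       (auto simp: bd_process_def intro: Least_le)
qed

lemma space_bd_noise[simp]: "space bd_noise = UNIV"
  by (simp add: bd_noise_def space_stream_space space_pair_measure)

text \<open>
  This excludes that the integral in the exponential functional takes the default value 0 of a
  nonintegrable function, which would spoil its additivity in time and its lower bounds.
\<close>

lemma integrable_path:
  fixes V :: "nat \<Rightarrow> real"
  assumes "bd_process a b x t \<omega> \<noteq> None"
  shows "set_integrable lborel {0..t} (\<lambda>s. eval0 V (bd_process a b x s \<omega>))"
proof -
  define N where "N = (LEAST n. t < bd_jump_time a b x \<omega> (Suc n))"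
  define B where "B = (\<Sum>n\<le>N. \<bar>V (bd_jump_chain a b x \<omega> n)\<bar>)"
  have B: "\<bar>eval0 V (bd_process a b x s \<omega>)\<bar> \<le> B" if s: "s \<le> t" for s
  proof -
    from bd_process_before[OF assms s] obtain n where n: "n \<le> N"
      "bd_process a b x s \<omega> = Some (bd_jump_chain a b x \<omega> n)"
      unfolding N_def by auto
    then have "\<bar>V (bd_jump_chain a b x \<omega> n)\<bar> \<le> B"
      unfolding B_def by (intro member_le_sum) auto
    with n show ?thesis by (simp add: eval0_def)
  qed
  have B0: "0 \<le> B" unfolding B_def by (intro sum_nonneg) auto
  show ?thesis
    unfolding set_integrable_def
  proof (rule Bochner_Integration.integrable_bound[of _ "\<lambda>s. indicator {0..t} s *\<^sub>R B"])
    show "integrable lborel (\<lambda>s. indicator {0..t} s *\<^sub>R B)"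
      by (auto intro!: integrable_real_indicator simp: emeasure_lborel_Icc_eq)
    show "AE s in lborel. norm (indicator {0..t} s *\<^sub>R eval0 V (bd_process a b x s \<omega>)) \<le> norm (indicator {0..t} s *\<^sub>R B)"
      using B B0 by (intro AE_I2) (auto simp: indicator_def)
  qed measurable
qed

text \<open>
  The integral splits at the end of the first holding time, so the functional is multiplicative.
  Holding times are nonnegative almost surely.
\<close>

lemma fk_path_Stream:
  assumes "0 \<le> t" "0 \<le> fst p" "0 < a x + b x"
  shows "fk_path a b V g x t (p ## \<omega>) =
    (if t < fst p / (a x + b x) then g x * ennreal (exp (- V x * t))
     else ennreal (exp (- V x * (fst p / (a x + b x)))) *
       fk_path a b V g (bd_target a b x (snd p)) (t - fst p / (a x + b x)) \<omega>)"
proof -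
  define r where "r = fst p / (a x + b x)"
  define y where "y = bd_target a b x (snd p)"
  have r0: "0 \<le> r" using assms by (simp add: r_def)
  have P: "bd_process a b x s (p ## \<omega>) = (if s < r then Some x else bd_process a b y (s - r) \<omega>)" for s
    unfolding bd_process_Stream r_def y_def ..
  show ?thesis
    unfolding r_def[symmetric] y_def[symmetric]
  proof (cases "t < r")
    case True
    have "(LBINT s:{0..t}. eval0 V (bd_process a b x s (p ## \<omega>))) = (LBINT s:{0..t}. V x)"
      using True by (intro set_lebesgue_integral_cong) (auto simp: P eval0_def)
    also have "\<dots> = V x * t" using assms by (simp add: set_lebesgue_integral_def)
    finally show "fk_path a b V g x t (p ## \<omega>) = (if t < r then g x * ennreal (exp (- V x * t))
     else ennreal (exp (- V x * r)) * fk_path a b V g y (t - r) \<omega>)"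
      using True by (simp add: fk_path_def P eval0_def)
  next
    case False
    show "fk_path a b V g x t (p ## \<omega>) = (if t < r then g x * ennreal (exp (- V x * t))
     else ennreal (exp (- V x * r)) * fk_path a b V g y (t - r) \<omega>)"
    proof (cases "bd_process a b y (t - r) \<omega>")
      case None
      with False show ?thesis by (simp add: fk_path_def P eval0_def)
    next
      case (Some z)
      with False have I: "set_integrable lborel {0..t} (\<lambda>s. eval0 V (bd_process a b x s (p ## \<omega>)))"
        by (intro integrable_path) (auto simp: P)
      have "{0..t} = {0..<r} \<union> {r..t}" using r0 False by auto
      then have "(LBINT s:{0..t}. eval0 V (bd_process a b x s (p ## \<omega>))) =
         (LBINT s:{0..<r} \<union> {r..t}. eval0 V (bd_process a b x s (p ## \<omega>)))" by simp
      also have "\<dots> = (LBINT s:{0..<r}. eval0 V (bd_process a b x s (p ## \<omega>))) +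
          (LBINT s:{r..t}. eval0 V (bd_process a b x s (p ## \<omega>)))"
        using r0 False by (intro set_integral_Un set_integrable_subset[OF I]) auto
      also have "(LBINT s:{0..<r}. eval0 V (bd_process a b x s (p ## \<omega>))) = (LBINT s:{0..<r}. V x)"
        by (intro set_lebesgue_integral_cong) (auto simp: P eval0_def)
      also have "\<dots> = V x * r" using r0 by (simp add: set_lebesgue_integral_def)
      also have "(LBINT s:{r..t}. eval0 V (bd_process a b x s (p ## \<omega>))) =
         (LBINT s:{r..t}. eval0 V (bd_process a b y (s - r) \<omega>))"
        by (intro set_lebesgue_integral_cong) (auto simp: P eval0_def)
      also have "\<dots> = (LBINT s:{0..t-r}. eval0 V (bd_process a b y s \<omega>))"
        unfolding set_lebesgue_integral_def
        by (subst lborel_integral_real_affine[of 1 _ r])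
           (auto intro!: Bochner_Integration.integral_cong simp: indicator_def)
      finally have "ennreal (exp (- (LBINT s:{0..t}. eval0 V (bd_process a b x s (p ## \<omega>))))) =
          ennreal (exp (- V x * r)) * ennreal (exp (- (LBINT s:{0..t-r}. eval0 V (bd_process a b y s \<omega>))))"
        by (simp add: ennreal_mult[symmetric] exp_add[symmetric])
      with False show ?thesis
        unfolding fk_path_def by (simp add: P[of t] mult.left_commute)
    qed
  qed
qed

text \<open>
  Truncation at fewer than \<open>n\<close> jumps turns the backward equation into a recursion on \<open>n\<close>.
\<close>

definition fk_upto ::
  "(nat \<Rightarrow> real) \<Rightarrow> (nat \<Rightarrow> real) \<Rightarrow> (nat \<Rightarrow> real) \<Rightarrow> (nat \<Rightarrow> ennreal) \<Rightarrow> nat \<Rightarrow> real \<Rightarrow> nat \<Rightarrow> ennreal" where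
  "fk_upto a b V g n t x = (\<integral>\<^sup>+\<omega>. (if fewer_jumps a b n x t \<omega> then fk_path a b V g x t \<omega> else 0) \<partial>bd_noise)"

lemma fk_upto_0: "fk_upto a b V g 0 t x = 0"
  by (simp add: fk_upto_def fewer_jumps_def)

lemma measurable_fk_upto_integrand[measurable]:
  "(\<lambda>(t, \<omega>). if fewer_jumps a b n x t \<omega> then fk_path a b V g x t \<omega> else 0) \<in> borel_measurable (borel \<Otimes>\<^sub>M bd_noise)"
  using measurable_fewer_jumps[of a b n x] measurable_fk_path[of a b V g x]
  unfolding case_prod_beta' by measurable

lemma measurable_fk_upto[measurable]: "(\<lambda>t. fk_upto a b V g n t x) \<in> borel_measurable borel"
proof -
  interpret prob_space bd_noise by (rule prob_space_bd_noise)
  show ?thesis unfolding fk_upto_def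
    by (rule borel_measurable_nn_integral) measurable
qed

lemma nn_integral_uniform_threshold:
  fixes p :: real and A B :: ennreal
  assumes "0 \<le> p" "p \<le> 1"
  shows "(\<integral>\<^sup>+v. (if v < p then A else B) \<partial>uniform_measure lborel {0..1}) = ennreal p * A + ennreal (1 - p) * B"
proof -
  have "(\<integral>\<^sup>+v. (if v < p then A else B) \<partial>uniform_measure lborel {0..1}) =
     (\<integral>\<^sup>+v. (if v < p then A else B) * indicator {0..1} v \<partial>lborel)"
    by (subst nn_integral_uniform_measure) (auto simp: divide_ennreal_def)
  also have "\<dots> = (\<integral>\<^sup>+v. A * indicator {0..<p} v + B * indicator {p..1} v \<partial>lborel)"
    using assms by (intro nn_integral_cong) (auto simp: indicator_def)
  also have "\<dots> = ennreal p * A + ennreal (1 - p) * B"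
    using assms by (subst nn_integral_add) (auto simp: nn_integral_cmult mult.commute)
  finally show ?thesis .
qed

text \<open>
  Integration over the first noise pair.  With \<open>q = a x + b x\<close>, the chain stays in \<open>x\<close> up to time
  \<open>t\<close> with probability \<open>exp (- q * t)\<close>; otherwise it jumps at a time \<open>s\<close> of density
  \<open>q * exp (- q * s)\<close>, to \<open>x + 1\<close> or \<open>x - 1\<close> with probabilities \<open>a x / q\<close> and \<open>b x / q\<close>.  The factor
  \<open>exp (- V x * s)\<close> is the weight accumulated in \<open>x\<close>.
\<close>

lemma fk_upto_first_jump:
  fixes g :: "nat \<Rightarrow> ennreal"
  assumes t: "0 \<le> t" and a: "0 \<le> a x" and b: "0 \<le> b x" and q: "0 < a x + b x"
  shows "fk_upto a b V g (Suc n) t x = g x * ennreal (exp (- (V x + (a x + b x)) * t)) +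
     (\<integral>\<^sup>+s. indicator {0..t} s * (ennreal (exp (- (V x + (a x + b x)) * s)) *
        (ennreal (a x) * fk_upto a b V g n (t - s) (x + 1) + ennreal (b x) * fk_upto a b V g n (t - s) (x - 1))) \<partial>lborel)"
proof -
  define q where "q = a x + b x"
  have q0: "0 < q" using q by (simp add: q_def)
  let ?E = "density lborel (\<lambda>e. ennreal (exponential_density 1 e))"
  let ?U = "uniform_measure lborel {0..1::real}"
  interpret U: prob_space ?U by (rule prob_space_uniform_measure) auto
  interpret N: prob_space bd_noise by (rule prob_space_bd_noise)
  define F where "F = (\<lambda>\<omega>. if fewer_jumps a b (Suc n) x t \<omega> then fk_path a b V g x t \<omega> else 0)"
  have F[measurable]: "F \<in> borel_measurable bd_noise"
    using measurable_compose[OF measurable_Pair1'[of t borel bd_noise] measurable_fk_upto_integrand[of a b "Suc n" x V g]]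
    by (simp add: F_def)
  have S: "(\<lambda>(p, \<omega>). p ## \<omega>) \<in> measurable (noise1 \<Otimes>\<^sub>M bd_noise) bd_noise"
    unfolding bd_noise_def by measurable
  define K where "K p = (\<integral>\<^sup>+\<omega>. F (p ## \<omega>) \<partial>bd_noise)" for p
  have K[measurable]: "K \<in> borel_measurable noise1"
    unfolding K_def using measurable_compose[OF S F]
    by (intro N.borel_measurable_nn_integral) (simp add: case_prod_beta')
  define J where "J e = (if t < e / q then g x * ennreal (exp (- V x * t))
     else ennreal (exp (- V x * (e / q))) *
       (ennreal (a x / q) * fk_upto a b V g n (t - e / q) (x + 1) +
        ennreal (b x / q) * fk_upto a b V g n (t - e / q) (x - 1)))" for e
  have J[measurable]: "J \<in> borel_measurable borel" unfolding J_def by measurable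
  have KJ: "(\<integral>\<^sup>+v. K (e, v) \<partial>?U) = J e" if e: "0 \<le> e" for e
  proof -
    define y where "y = bd_target a b x"
    have "K (e, v) = (if t < e / q then g x * ennreal (exp (- V x * t))
        else ennreal (exp (- V x * (e / q))) * fk_upto a b V g n (t - e / q) (y v))" for v
    proof -
      have m: "(\<lambda>\<omega>. if fewer_jumps a b n (y v) (t - e / q) \<omega> then fk_path a b V g (y v) (t - e / q) \<omega> else 0)
          \<in> borel_measurable bd_noise"
        using measurable_compose[OF measurable_Pair1'[of "t - e / q" borel bd_noise] measurable_fk_upto_integrand[of
            a b n "y v" V g]]
        by simp
      have "F ((e, v) ## \<omega>) = (if t < e / q then g x * ennreal (exp (- V x * t)) else
          ennreal (exp (- V x * (e / q))) *
          (if fewer_jumps a b n (y v) (t - e / q) \<omega> then fk_path a b V g (y v) (t - e / q) \<omega> else 0))" for \<omega>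
        using t e q by (simp add: F_def fewer_jumps_Stream fk_path_Stream q_def y_def)
      then show ?thesis
        unfolding K_def by (auto simp: fk_upto_def nn_integral_cmult[OF m] N.emeasure_space_1[unfolded space_bd_noise])
    qed
    then have "(\<integral>\<^sup>+v. K (e, v) \<partial>?U) = (\<integral>\<^sup>+v. (if v < a x / q then
        (if t < e / q then g x * ennreal (exp (- V x * t))
        else ennreal (exp (- V x * (e / q))) * fk_upto a b V g n (t - e / q) (x + 1)) else
        (if t < e / q then g x * ennreal (exp (- V x * t))
        else ennreal (exp (- V x * (e / q))) * fk_upto a b V g n (t - e / q) (x - 1))) \<partial>?U)"
      by (intro nn_integral_cong) (auto simp: y_def bd_target_def q_def)
    also have "\<dots> = ennreal (a x / q) * (if t < e / q then g x * ennreal (exp (- V x * t))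
        else ennreal (exp (- V x * (e / q))) * fk_upto a b V g n (t - e / q) (x + 1)) + ennreal (1 - a x / q) *
        (if t < e / q then g x * ennreal (exp (- V x * t))
        else ennreal (exp (- V x * (e / q))) * fk_upto a b V g n (t - e / q) (x - 1))"
      using a b q0 by (intro nn_integral_uniform_threshold) (auto simp: q_def)
    also have "1 - a x / q = b x / q" using q0 by (simp add: q_def field_simps)
    also have "ennreal (a x / q) * (if t < e / q then g x * ennreal (exp (- V x * t))
        else ennreal (exp (- V x * (e / q))) * fk_upto a b V g n (t - e / q) (x + 1)) + ennreal (b x / q) *
        (if t < e / q then g x * ennreal (exp (- V x * t))
        else ennreal (exp (- V x * (e / q))) * fk_upto a b V g n (t - e / q) (x - 1)) = J e"
    proof (cases "t < e / q")
      case True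
      have "ennreal (a x / q) + ennreal (b x / q) = 1"
        using a b q0 by (simp add: ennreal_plus[symmetric] add_divide_distrib[symmetric] q_def[symmetric] del: ennreal_plus)
      with True show ?thesis by (simp add: J_def distrib_right[symmetric])
    next
      case False
      then show ?thesis by (simp add: J_def distrib_left mult.left_commute)
    qed
    finally show ?thesis .
  qed
  have "fk_upto a b V g (Suc n) t x = (\<integral>\<^sup>+\<omega>. F \<omega> \<partial>bd_noise)"
    by (simp add: fk_upto_def F_def)
  also have "\<dots> = (\<integral>\<^sup>+p. K p \<partial>noise1)"
    unfolding K_def using F unfolding bd_noise_def
    by (rule prob_space.nn_integral_stream_space[OF prob_space_noise1])
  also have "\<dots> = (\<integral>\<^sup>+e. \<integral>\<^sup>+v. K (e, v) \<partial>?U \<partial>?E)"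
    by (rule U.nn_integral_fst[symmetric]) measurable
  also have "\<dots> = (\<integral>\<^sup>+e. ennreal (exponential_density 1 e) * (\<integral>\<^sup>+v. K (e, v) \<partial>?U) \<partial>lborel)"
  proof (rule nn_integral_density)
    have "(\<lambda>e. \<integral>\<^sup>+v. K (e, v) \<partial>?U) \<in> borel_measurable ?E"
      by (rule U.borel_measurable_nn_integral) measurable
    then show "(\<lambda>e. \<integral>\<^sup>+v. K (e, v) \<partial>?U) \<in> borel_measurable lborel" by simp
  qed simp
  also have "\<dots> = (\<integral>\<^sup>+e. ennreal (exponential_density 1 e) * J e \<partial>lborel)"
    by (intro nn_integral_cong) (auto simp: KJ exponential_density_def)
  also have "\<dots> = ennreal q * (\<integral>\<^sup>+s. ennreal (exponential_density 1 (q * s)) * J (q * s) \<partial>lborel)"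
    using q0 by (subst nn_integral_real_affine[where c = q and t = 0]) auto
  also have "\<dots> = (\<integral>\<^sup>+s. ennreal q * (ennreal (exponential_density 1 (q * s)) * J (q * s)) \<partial>lborel)"
    by (rule nn_integral_cmult[symmetric]) measurable
  also have "\<dots> = (\<integral>\<^sup>+s. g x * ennreal (exp (- V x * t)) * (ennreal (q * exp (- q * s)) * indicator {t..} s) +
      indicator {0..t} s * (ennreal (exp (- (V x + q) * s)) *
        (ennreal (a x) * fk_upto a b V g n (t - s) (x + 1) + ennreal (b x) * fk_upto a b V g n (t - s) (x - 1))) \<partial>lborel)"
  \<comment> \<open>Holding times beyond \<open>t\<close> contribute the first summand, those up to \<open>t\<close> the second; the null
    event \<open>s = t\<close> is discarded.\<close>
  proof (rule nn_integral_cong_AE, rule AE_mp[OF AE_lborel_singleton[of t]], rule AE_I2, rule impI)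
    fix s assume st: "s \<noteq> t"
    consider "s < 0" | "0 \<le> s" "s < t" | "t < s" using st by linarith
    then show "ennreal q * (ennreal (exponential_density 1 (q * s)) * J (q * s)) =
      g x * ennreal (exp (- V x * t)) * (ennreal (q * exp (- q * s)) * indicator {t..} s) +
      indicator {0..t} s * (ennreal (exp (- (V x + q) * s)) *
        (ennreal (a x) * fk_upto a b V g n (t - s) (x + 1) + ennreal (b x) * fk_upto a b V g n (t - s) (x - 1)))"
    proof cases
      case 1
      then show ?thesis using q0 t by (simp add: exponential_density_def mult_pos_neg)
    next
      case 3
      then show ?thesis using q0 t by (simp add: exponential_density_def J_def ennreal_mult mult_ac mult_less_0_iff)
    next
      case 2
      define X Y where "X = fk_upto a b V g n (t - s) (x + 1)" and "Y = fk_upto a b V g n (t - s) (x - 1)"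
      define e f where "e = exp (- q * s)" and "f = exp (- V x * s)"
      have ef: "exp (- (V x + q) * s) = e * f" "0 < e" "0 < f"
        by (auto simp: e_def f_def exp_add[symmetric] algebra_simps)
      have A: "ennreal q * ennreal (a x / q) = ennreal (a x)" "ennreal q * ennreal (b x / q) = ennreal (b x)"
        using q0 a b by (auto simp: ennreal_mult[symmetric])
      have "ennreal q * (ennreal (exponential_density 1 (q * s)) * J (q * s)) =
          ennreal q * (ennreal e * (ennreal f * (ennreal (a x / q) * X + ennreal (b x / q) * Y)))"
        using 2 q0 by (simp add: exponential_density_def J_def X_def Y_def e_def f_def mult.commute mult_less_0_iff)
      also have "\<dots> = ennreal e * ennreal f * ((ennreal q * ennreal (a x / q)) * X + (ennreal q * ennreal (b x / q)) * Y)"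
        by (simp add: distrib_left mult_ac)
      also have "\<dots> = ennreal (e * f) * (ennreal (a x) * X + ennreal (b x) * Y)"
        using ef A by (simp add: ennreal_mult)
      finally show ?thesis
        using 2 by (simp add: ef(1)[symmetric] X_def Y_def)
    qed
  qed
  also have "\<dots> = g x * ennreal (exp (- V x * t)) * (\<integral>\<^sup>+s. ennreal (q * exp (- q * s)) * indicator {t..} s \<partial>lborel) +
      (\<integral>\<^sup>+s. indicator {0..t} s * (ennreal (exp (- (V x + q) * s)) *
        (ennreal (a x) * fk_upto a b V g n (t - s) (x + 1) + ennreal (b x) * fk_upto a b V g n (t - s) (x - 1))) \<partial>lborel)"
    by (subst nn_integral_add) (auto intro!: nn_integral_cmult)
  also have "(\<integral>\<^sup>+s. ennreal (q * exp (- q * s)) * indicator {t..} s \<partial>lborel) = ennreal (0 - (- exp (- q * t)))"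
  proof (rule nn_integral_FTC_atLeast)
    have "((\<lambda>s. exp (- q * s)) \<longlongrightarrow> 0) at_top"
      by (rule filterlim_compose[OF exp_at_bot], rule filterlim_tendsto_neg_mult_at_bot[OF tendsto_const _ filterlim_ident])
         (use q0 in simp)
    from tendsto_minus[OF this] show "((\<lambda>s. - exp (- q * s)) \<longlongrightarrow> 0) at_top" by simp
  qed (use q0 in \<open>auto intro!: derivative_eq_intros\<close>)
  also have "g x * ennreal (exp (- V x * t)) * ennreal (0 - (- exp (- q * t))) = g x * ennreal (exp (- (V x + q) * t))"
    by (simp add: mult.assoc ennreal_mult[symmetric] exp_add[symmetric] algebra_simps)
  finally show ?thesis by (simp add: q_def)
qed

text \<open>
  The same recursion after reversal of time in the integral.  Now \<open>t\<close> occurs only as the upper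
  limit, so that the equation can be differentiated.
\<close>

lemma fk_upto_Suc:
  fixes g :: "nat \<Rightarrow> ennreal"
  assumes t: "0 \<le> t" and a: "0 \<le> a x" and b: "0 \<le> b x" and q: "0 < a x + b x"
  shows "ennreal (exp ((V x + (a x + b x)) * t)) * fk_upto a b V g (Suc n) t x = g x +
     (\<integral>\<^sup>+r. indicator {0..t} r * (ennreal (exp ((V x + (a x + b x)) * r)) *
        (ennreal (a x) * fk_upto a b V g n r (x + 1) + ennreal (b x) * fk_upto a b V g n r (x - 1))) \<partial>lborel)"
proof -
  define c where "c = V x + (a x + b x)"
  have E: "ennreal (exp (c * t)) * ennreal (exp (- c * s)) = ennreal (exp (c * (t - s)))" for s
    by (simp add: ennreal_mult[symmetric] exp_add[symmetric] algebra_simps)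
  have "ennreal (exp (c * t)) * fk_upto a b V g (Suc n) t x =
     ennreal (exp (c * t)) * (g x * ennreal (exp (- c * t))) + ennreal (exp (c * t)) *
     (\<integral>\<^sup>+s. indicator {0..t} s * (ennreal (exp (- c * s)) *
        (ennreal (a x) * fk_upto a b V g n (t - s) (x + 1) + ennreal (b x) * fk_upto a b V g n (t - s) (x - 1))) \<partial>lborel)"
    unfolding fk_upto_first_jump[of t a x b V g n, OF assms] c_def[symmetric] by (rule distrib_left)
  also have "ennreal (exp (c * t)) * (g x * ennreal (exp (- c * t))) = g x"
    using E[of t] by (simp add: mult.left_commute[of _ "g x"])
  also have "ennreal (exp (c * t)) * (\<integral>\<^sup>+s. indicator {0..t} s * (ennreal (exp (- c * s)) *
        (ennreal (a x) * fk_upto a b V g n (t - s) (x + 1) + ennreal (b x) * fk_upto a b V g n (t - s) (x - 1))) \<partial>lborel) =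
     (\<integral>\<^sup>+s. ennreal (exp (c * t)) * (indicator {0..t} s * (ennreal (exp (- c * s)) *
        (ennreal (a x) * fk_upto a b V g n (t - s) (x + 1) + ennreal (b x) * fk_upto a b V g n (t - s) (x - 1)))) \<partial>lborel)"
    by (rule nn_integral_cmult[symmetric]) measurable
  also have "\<dots> = (\<integral>\<^sup>+s. indicator {0..t} s * (ennreal (exp (c * (t - s))) *
        (ennreal (a x) * fk_upto a b V g n (t - s) (x + 1) + ennreal (b x) * fk_upto a b V g n (t - s) (x - 1))) \<partial>lborel)"
    unfolding E[symmetric] by (intro nn_integral_cong) (simp add: mult_ac)
  also have "\<dots> = (\<integral>\<^sup>+r. indicator {0..t} r * (ennreal (exp (c * r)) *
        (ennreal (a x) * fk_upto a b V g n r (x + 1) + ennreal (b x) * fk_upto a b V g n r (x - 1))) \<partial>lborel)"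
    by (subst nn_integral_real_affine[where c = "-1" and t = t])
       (auto intro!: nn_integral_cong simp: indicator_def)
  finally show ?thesis by (simp add: c_def)
qed

definition fk ::
  "(nat \<Rightarrow> real) \<Rightarrow> (nat \<Rightarrow> real) \<Rightarrow> (nat \<Rightarrow> real) \<Rightarrow> (nat \<Rightarrow> ennreal) \<Rightarrow> real \<Rightarrow> nat \<Rightarrow> ennreal" where
  "fk a b V g t x = (\<integral>\<^sup>+\<omega>. fk_path a b V g x t \<omega> \<partial>bd_noise)"

lemma feynman_kac_eq_fk: "feynman_kac a b V t x = fk a b V (\<lambda>_. 1) t x"
  unfolding feynman_kac_def fk_def fk_path_def
  by (intro nn_integral_cong) (auto simp: eval0_def split: option.split)

lemma bd_semigroup_nn_eq_fk: "bd_semigroup_nn a b t g x = fk a b (\<lambda>_. 0) g t x"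
proof -
  have "eval0 (\<lambda>_. 0 :: real) z = 0" for z by (simp add: eval0_def split: option.split)
  then show ?thesis
    unfolding bd_semigroup_nn_def fk_def fk_path_def by simp
qed

lemma measurable_fk[measurable]: "(\<lambda>t. fk a b V g t x) \<in> borel_measurable borel"
proof -
  interpret prob_space bd_noise by (rule prob_space_bd_noise)
  show ?thesis unfolding fk_def by (rule borel_measurable_nn_integral) measurable
qed

lemma incseq_fk_upto: "incseq (\<lambda>n. fk_upto a b V g n t x)"
  unfolding fk_upto_def fewer_jumps_def
  by (intro incseq_SucI nn_integral_mono) (auto simp: less_Suc_eq)

lemma fk_upto_LIMSEQ: "(\<lambda>n. fk_upto a b V g n t x) \<longlonglongrightarrow> fk a b V g t x"
  unfolding fk_upto_def fk_def
proof (rule nn_integral_LIMSEQ)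
  show "incseq (\<lambda>n \<omega>. if fewer_jumps a b n x t \<omega> then fk_path a b V g x t \<omega> else 0)"
    by (intro incseq_SucI le_funI) (auto simp: fewer_jumps_def less_Suc_eq)
  show "(\<lambda>\<omega>. if fewer_jumps a b n x t \<omega> then fk_path a b V g x t \<omega> else 0) \<in> borel_measurable bd_noise" for n
    using measurable_compose[OF measurable_Pair1'[of t borel bd_noise] measurable_fk_upto_integrand[of a b n x V g]] by simp
  show "(\<lambda>n. if fewer_jumps a b n x t \<omega> then fk_path a b V g x t \<omega> else 0) \<longlonglongrightarrow> fk_path a b V g x t \<omega>" for \<omega>
  proof (cases "\<exists>k. t < bd_jump_time a b x \<omega> (Suc k)")
    case True
    then obtain k where "t < bd_jump_time a b x \<omega> (Suc k)" by blast
    then have "\<forall>\<^sub>F n in sequentially. (if fewer_jumps a b n x t \<omega> then fk_path a b V g x t \<omega> else 0)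
        = fk_path a b V g x t \<omega>"
      by (intro eventually_mono[OF eventually_gt_at_top[of k]]) (auto simp: fewer_jumps_def)
    then show ?thesis by (rule tendsto_eventually)
  next
    case False
    then show ?thesis by (simp add: fk_path_def bd_process_def eval0_def fewer_jumps_def)
  qed
qed

text \<open>
  The recursion for the truncated functionals in the limit, by monotone convergence on either side.
\<close>

lemma fk_equation:
  fixes g :: "nat \<Rightarrow> ennreal"
  assumes "0 \<le> t" "0 \<le> a x" "0 \<le> b x" "0 < a x + b x"
  shows "ennreal (exp ((V x + (a x + b x)) * t)) * fk a b V g t x = g x +
     (\<integral>\<^sup>+r. indicator {0..t} r * (ennreal (exp ((V x + (a x + b x)) * r)) *
        (ennreal (a x) * fk a b V g r (x + 1) + ennreal (b x) * fk a b V g r (x - 1))) \<partial>lborel)"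
proof (rule LIMSEQ_unique)
  show "(\<lambda>n. ennreal (exp ((V x + (a x + b x)) * t)) * fk_upto a b V g (Suc n) t x) \<longlonglongrightarrow>
    ennreal (exp ((V x + (a x + b x)) * t)) * fk a b V g t x"
    by (intro ennreal_tendsto_cmult LIMSEQ_Suc fk_upto_LIMSEQ) simp
  show "(\<lambda>n. ennreal (exp ((V x + (a x + b x)) * t)) * fk_upto a b V g (Suc n) t x) \<longlonglongrightarrow> g x +
     (\<integral>\<^sup>+r. indicator {0..t} r * (ennreal (exp ((V x + (a x + b x)) * r)) *
        (ennreal (a x) * fk a b V g r (x + 1) + ennreal (b x) * fk a b V g r (x - 1))) \<partial>lborel)"
    unfolding fk_upto_Suc[of t a x b V g, OF assms]
  proof (intro tendsto_add tendsto_const nn_integral_LIMSEQ)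
    show "incseq (\<lambda>n r. indicator {0..t} r * (ennreal (exp ((V x + (a x + b x)) * r)) *
        (ennreal (a x) * fk_upto a b V g n r (x + 1) + ennreal (b x) * fk_upto a b V g n r (x - 1))))"
      using incseq_fk_upto[of a b V g, THEN incseq_SucD]
      by (intro incseq_SucI le_funI mult_left_mono add_mono) auto
    show "(\<lambda>n. indicator {0..t} r * (ennreal (exp ((V x + (a x + b x)) * r)) *
        (ennreal (a x) * fk_upto a b V g n r (x + 1) + ennreal (b x) * fk_upto a b V g n r (x - 1)))) \<longlonglongrightarrow>
        indicator {0..t} r * (ennreal (exp ((V x + (a x + b x)) * r)) *
        (ennreal (a x) * fk a b V g r (x + 1) + ennreal (b x) * fk a b V g r (x - 1)))" for r
      by (intro ennreal_tendsto_cmult tendsto_add fk_upto_LIMSEQ) (auto simp: indicator_def)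
  qed measurable
qed

text \<open>
  Every nonnegative supersolution of the backward equation dominates the expectation, because it
  dominates each truncation by induction on the number of jumps.
\<close>

lemma fk_minimal:
  fixes g :: "nat \<Rightarrow> ennreal" and H :: "real \<Rightarrow> nat \<Rightarrow> ennreal"
  assumes rates: "\<And>x. 0 \<le> a x" "\<And>x. 0 \<le> b x" "\<And>x. 0 < a x + b x"
    and H: "\<And>t x. 0 \<le> t \<Longrightarrow> g x +
     (\<integral>\<^sup>+r. indicator {0..t} r * (ennreal (exp ((V x + (a x + b x)) * r)) *
        (ennreal (a x) * H r (x + 1) + ennreal (b x) * H r (x - 1))) \<partial>lborel)
        \<le> ennreal (exp ((V x + (a x + b x)) * t)) * H t x"
    and "0 \<le> t"
  shows "fk a b V g t x \<le> H t x"
proof -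
  have "fk_upto a b V g n t x \<le> H t x" if "0 \<le> t" for n t x
    using that
  proof (induction n arbitrary: t x)
    case (Suc n)
    have "ennreal (exp ((V x + (a x + b x)) * t)) * fk_upto a b V g (Suc n) t x \<le> g x +
     (\<integral>\<^sup>+r. indicator {0..t} r * (ennreal (exp ((V x + (a x + b x)) * r)) *
        (ennreal (a x) * H r (x + 1) + ennreal (b x) * H r (x - 1))) \<partial>lborel)"
      unfolding fk_upto_Suc[of t a x b V g, OF Suc.prems rates]
      by (intro add_left_mono nn_integral_mono) (auto simp: indicator_def intro!: mult_left_mono add_mono Suc.IH)
    also have "\<dots> \<le> ennreal (exp ((V x + (a x + b x)) * t)) * H t x" by (rule H[OF Suc.prems])
    finally show ?case
      using ennreal_mult_le_mult_iff[of "ennreal (exp ((V x + (a x + b x)) * t))" "fk_upto a b V g (Suc n) t x" "H t x"]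
      by simp
  qed (simp add: fk_upto_0)
  then show ?thesis
    using \<open>0 \<le> t\<close> by (intro LIMSEQ_le_const2[OF fk_upto_LIMSEQ]) auto
qed

lemma fk_monotone_convergence:
  assumes "incseq g" and "\<And>x. (\<lambda>n. g n x) \<longlonglongrightarrow> G x"
  shows "(\<lambda>n. fk a b V (g n) t x) \<longlonglongrightarrow> fk a b V G t x"
  unfolding fk_def
proof (rule nn_integral_LIMSEQ)
  show "incseq (\<lambda>n \<omega>. fk_path a b V (g n) x t \<omega>)"
    using assms(1) unfolding fk_path_def
    by (intro incseq_SucI le_funI mult_right_mono)
       (auto simp: eval0_def split: option.split dest: incseq_SucD le_funD)
  show "(\<lambda>n. fk_path a b V (g n) x t \<omega>) \<longlonglongrightarrow> fk_path a b V G x t \<omega>" for \<omega>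
    unfolding fk_path_def mult.commute[of _ "ennreal _"]
    by (intro ennreal_tendsto_cmult) (auto simp: eval0_def assms split: option.split)
qed measurable

lemma fk_le_const:
  assumes "\<And>x. g x \<le> B"
  shows "fk a b (\<lambda>_. 0) g t x \<le> B"
proof -
  interpret N: prob_space bd_noise by (rule prob_space_bd_noise)
  have z: "eval0 (\<lambda>_. 0 :: real) z = 0" for z by (simp add: eval0_def split: option.split)
  have "fk a b (\<lambda>_. 0) g t x \<le> (\<integral>\<^sup>+\<omega>. B \<partial>bd_noise)"
    unfolding fk_def fk_path_def z
    using assms by (intro nn_integral_mono) (auto simp: eval0_def split: option.split)
  also have "\<dots> = B" using N.emeasure_space_1 by simp
  finally show ?thesis .
qed

text \<open>
  A finite bound turns the integral equation into a differential equation: the integral is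
  continuous in \<open>t\<close>, hence so is the functional, hence so is the integrand.
\<close>

lemma fk_has_derivative:
  fixes g :: "nat \<Rightarrow> real"
  assumes rates: "\<And>x. 0 \<le> a x" "\<And>x. 0 \<le> b x" "\<And>x. 0 < a x + b x"
    and g: "\<And>x. 0 \<le> g x"
    and B: "\<And>t x. 0 \<le> t \<Longrightarrow> fk a b V (\<lambda>x. ennreal (g x)) t x \<le> ennreal (B x)"
    and h_def: "\<And>t x. h t x = enn2real (fk a b V (\<lambda>x. ennreal (g x)) t x)"
  shows "h 0 x = g x"
    and "t \<in> {0..T} \<Longrightarrow> ((\<lambda>t. h t x) has_real_derivative
      (a x * h t (x + 1) + b x * h t (x - 1) - (V x + (a x + b x)) * h t x)) (at t within {0..T})"
proof -
  define c where "c x = V x + (a x + b x)" for x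
  define \<phi> where "\<phi> x r = exp (c x * r) * (a x * h r (x + 1) + b x * h r (x - 1))" for x r
  have fk_h: "fk a b V (\<lambda>x. ennreal (g x)) t x = ennreal (h t x)" if "0 \<le> t" for t x
    unfolding h_def using B[OF that, of x] by (simp add: ennreal_enn2real_if top.not_eq_extremum le_less_trans)
  have h0: "0 \<le> h t x" for t x by (simp add: h_def)
  have hB: "h t x \<le> max 0 (B x)" if "0 \<le> t" for t x
    using B[OF that, of x] unfolding fk_h[OF that] by (auto simp: ennreal_le_iff2)
  have [measurable]: "(\<lambda>t. h t x) \<in> borel_measurable borel" for x unfolding h_def by measurable
  have [measurable]: "\<phi> x \<in> borel_measurable borel" for x unfolding \<phi>_def by measurable
  have \<phi>0: "0 \<le> \<phi> x r" for x r using rates h0 by (simp add: \<phi>_def)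
  have \<phi>I: "set_integrable lborel {0..t} (\<phi> x)" for x t
    unfolding set_integrable_def
  proof (rule Bochner_Integration.integrable_bound)
    let ?M = "exp (\<bar>c x\<bar> * t) * (a x * max 0 (B (x + 1)) + b x * max 0 (B (x - 1)))"
    show "integrable lborel (\<lambda>s. indicator {0..t} s *\<^sub>R ?M)"
      by (auto intro!: integrable_real_indicator simp: emeasure_lborel_Icc_eq)
    have "\<phi> x r \<le> ?M" if "0 \<le> r" "r \<le> t" for r
      unfolding \<phi>_def using that rates h0 hB
      by (intro mult_mono add_mono) (auto intro!: mult_mono add_nonneg_nonneg mult_nonneg_nonneg)
    then have "norm (indicator {0..t} r *\<^sub>R \<phi> x r) \<le> norm (indicator {0..t} r *\<^sub>R ?M)" for r
      using \<phi>0[of x r] by (auto simp: indicator_def intro: order_trans[OF _ abs_ge_self])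
    then show "AE r in lborel. norm (indicator {0..t} r *\<^sub>R \<phi> x r) \<le> norm (indicator {0..t} r *\<^sub>R ?M)"
      by (intro AE_I2)
  qed measurable
  have eq: "exp (c x * t) * h t x = g x + integral {0..t} (\<phi> x)" if t: "0 \<le> t" for t x
  proof -
    have "ennreal (exp (c x * t) * h t x) = ennreal (exp (c x * t)) * fk a b V (\<lambda>x. ennreal (g x)) t x"
      using h0 by (simp add: fk_h[OF t] ennreal_mult)
    also have "\<dots> = ennreal (g x) + (\<integral>\<^sup>+r. indicator {0..t} r * (ennreal (exp (c x * r)) *
        (ennreal (a x) * fk a b V (\<lambda>x. ennreal (g x)) r (x + 1)
            + ennreal (b x) * fk a b V (\<lambda>x. ennreal (g x)) r (x - 1))) \<partial>lborel)"
      unfolding c_def by (rule fk_equation[OF t rates])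
    also have "(\<integral>\<^sup>+r. indicator {0..t} r * (ennreal (exp (c x * r)) *
        (ennreal (a x) * fk a b V (\<lambda>x. ennreal (g x)) r (x + 1)
            + ennreal (b x) * fk a b V (\<lambda>x. ennreal (g x)) r (x - 1))) \<partial>lborel) =
        (\<integral>\<^sup>+r. ennreal (indicator {0..t} r *\<^sub>R \<phi> x r) \<partial>lborel)"
      using rates h0 by (intro nn_integral_cong) (auto simp: indicator_def \<phi>_def fk_h ennreal_mult)
    also have "\<dots> = ennreal (LBINT r:{0..t}. \<phi> x r)"
      unfolding set_lebesgue_integral_def using \<phi>I \<phi>0
      by (intro nn_integral_eq_integral) (auto simp: set_integrable_def)
    also have "(LBINT r:{0..t}. \<phi> x r) = integral {0..t} (\<phi> x)"
      by (rule set_borel_integral_eq_integral(2)[OF \<phi>I])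
    also have "ennreal (g x) + ennreal (integral {0..t} (\<phi> x)) = ennreal (g x + integral {0..t} (\<phi> x))"
      using g \<phi>0 by (simp add: integral_nonneg set_borel_integral_eq_integral(1)[OF \<phi>I])
    finally show ?thesis
      using g h0 \<phi>0 by (subst (asm) ennreal_inj) (auto intro!: add_nonneg_nonneg mult_nonneg_nonneg integral_nonneg
          set_borel_integral_eq_integral(1)[OF \<phi>I])
  qed
  have h_eq: "h t x = exp (- c x * t) * (g x + integral {0..t} (\<phi> x))" if t: "0 \<le> t" for t x
    unfolding eq[OF t, symmetric] by (simp add: mult.assoc[symmetric] exp_add[symmetric])
  show "h 0 x = g x" by (simp add: h_eq)
  have hc: "continuous_on {0..T} (\<lambda>t. h t x)" for x
  proof -
    have "continuous_on {0..T} (\<lambda>t. exp (- c x * t) * (g x + integral {0..t} (\<phi> x)))"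
      by (intro continuous_intros indefinite_integral_continuous_1 set_borel_integral_eq_integral(1)[OF \<phi>I])
    then show ?thesis by (rule continuous_on_eq) (simp add: h_eq)
  qed
  assume t: "t \<in> {0..T}"
  have "continuous_on {0..T} (\<phi> x)"
    unfolding \<phi>_def by (intro continuous_intros hc)
  then have d: "((\<lambda>t. integral {0..t} (\<phi> x)) has_real_derivative \<phi> x t) (at t within {0..T})"
    using t by (rule integral_has_real_derivative)
  have "((\<lambda>t. exp (- c x * t) * (g x + integral {0..t} (\<phi> x))) has_real_derivative
      exp (- c x * t) * \<phi> x t - c x * (exp (- c x * t) * (g x + integral {0..t} (\<phi> x)))) (at t within {0..T})"
    by (auto intro!: derivative_eq_intros d simp: algebra_simps)
  also have "exp (- c x * t) * (g x + integral {0..t} (\<phi> x)) = h t x"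
    using t by (simp add: h_eq)
  also have "exp (- c x * t) * \<phi> x t = a x * h t (x + 1) + b x * h t (x - 1)"
    by (simp add: \<phi>_def mult.assoc[symmetric] exp_add[symmetric])
  finally show "((\<lambda>t. h t x) has_real_derivative
      (a x * h t (x + 1) + b x * h t (x - 1) - (V x + (a x + b x)) * h t x)) (at t within {0..T})"
    using t unfolding c_def[symmetric]
    by (rule has_field_derivative_transform_within[OF _ zero_less_one]) (auto simp: h_eq)
qed

section \<open>A comparison principle and Reuter's criterion\<close>

text \<open>
  A maximum principle on an infinite set of states.  Subtracting \<open>\<epsilon> * (\<phi> s + (K + 1) * t)\<close> from
  \<open>G\<close> makes a positive supremum attained, since \<open>G\<close> is bounded above and \<open>\<phi>\<close> has finite sublevel
  sets.  At a maximal point the time derivative of the difference must be nonnegative, while the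
  hypothesis on maximizers of \<open>G - \<epsilon> * \<phi>\<close> makes it at most \<open>- \<epsilon>\<close>.  The states are arbitrary so
  that the principle also applies to pairs of states.
\<close>

lemma comparison_principle:
  fixes G G' :: "real \<Rightarrow> 'a \<Rightarrow> real" and \<phi> :: "'a \<Rightarrow> real"
  assumes fin: "\<And>C. finite {s \<in> S. \<phi> s \<le> C}"
    and bound: "\<And>t s. t \<in> {0..T} \<Longrightarrow> s \<in> S \<Longrightarrow> G t s \<le> B"
    and init: "\<And>s. s \<in> S \<Longrightarrow> G 0 s \<le> 0"
    and pos: "\<And>s. s \<in> S \<Longrightarrow> 0 \<le> \<phi> s" and K: "0 \<le> K"
    and der: "\<And>t s. t \<in> {0..T} \<Longrightarrow> s \<in> S \<Longrightarrow>
      ((\<lambda>t. G t s) has_real_derivative G' t s) (at t within {0..T})"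
    and max: "\<And>t s \<epsilon>. 0 < \<epsilon> \<Longrightarrow> t \<in> {0..T} \<Longrightarrow> s \<in> S \<Longrightarrow> 0 < G t s \<Longrightarrow>
      (\<And>s'. s' \<in> S \<Longrightarrow> G t s' - \<epsilon> * \<phi> s' \<le> G t s - \<epsilon> * \<phi> s) \<Longrightarrow> G' t s \<le> \<epsilon> * K"
    and ts: "t \<in> {0..T}" "s \<in> S"
  shows "G t s \<le> 0"
proof -
  have le: "G t s \<le> \<epsilon> * (\<phi> s + (K + 1) * t)" if \<epsilon>: "0 < \<epsilon>" and t: "t \<in> {0..T}" and s: "s \<in> S" for \<epsilon> t s
  proof (rule ccontr)
    define H where "H t s = G t s - \<epsilon> * (\<phi> s + (K + 1) * t)" for t s
    assume "\<not> ?thesis"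
    then have Hpos: "0 < H t s" by (simp add: H_def)
    define F where "F = {s \<in> S. \<phi> s \<le> B / \<epsilon>}"
    have F: "finite F" unfolding F_def by (rule fin)
    have in_F: "s \<in> F" if "0 < H t s" "t \<in> {0..T}" "s \<in> S" for t s
    proof -
      have "\<epsilon> * \<phi> s + \<epsilon> * (K + 1) * t < B"
        using that bound[of t s] by (simp add: H_def algebra_simps)
      moreover have "0 \<le> \<epsilon> * (K + 1) * t" using \<epsilon> K that by simp
      ultimately have "\<epsilon> * \<phi> s \<le> B" by linarith
      then show ?thesis using \<epsilon> that by (simp add: F_def pos_le_divide_eq mult.commute)
    qed
    have dH: "((\<lambda>t. H t s) has_real_derivative G' t s - \<epsilon> * (K + 1)) (at t within {0..T})"
      if "t \<in> {0..T}" "s \<in> S" for t s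
      unfolding H_def using der[OF that] by (auto intro!: derivative_eq_intros)
    have "\<exists>\<tau>\<in>{0..T}. \<forall>t\<in>{0..T}. H t s \<le> H \<tau> s" if "s \<in> S" for s
    proof (rule continuous_attains_sup)
      show "continuous_on {0..T} (\<lambda>t. H t s)"
        by (rule DERIV_continuous_on[OF dH]) (use that in auto)
    qed (use t in auto)
    then obtain \<tau> where \<tau>: "\<And>s. s \<in> S \<Longrightarrow> \<tau> s \<in> {0..T}" "\<And>s t. s \<in> S \<Longrightarrow> t \<in> {0..T} \<Longrightarrow> H t s \<le> H (\<tau> s) s"
      by metis
    \<comment> \<open>Maximize in time for each of the finitely many relevant states, then over these states.\<close>
    have "F \<noteq> {}" using in_F[OF Hpos t s] by auto
    define M where "M = Max ((\<lambda>s. H (\<tau> s) s) ` F)"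
    have "M \<in> (\<lambda>s. H (\<tau> s) s) ` F" unfolding M_def using F \<open>F \<noteq> {}\<close> by (intro Max_in) auto
    then obtain z where "z \<in> F" "M = H (\<tau> z) z" by blast
    moreover have "H (\<tau> s) s \<le> M" if "s \<in> F" for s
      unfolding M_def using F that by (intro Max_ge) auto
    ultimately have z: "z \<in> F" "\<And>s. s \<in> F \<Longrightarrow> H (\<tau> s) s \<le> H (\<tau> z) z" by auto
    have zS: "z \<in> S" using z by (simp add: F_def)
    have Hz: "0 < H (\<tau> z) z"
      using Hpos \<tau>(2)[OF s t] z(2)[OF in_F[OF Hpos t s]] by linarith
    have all: "H t s \<le> H (\<tau> z) z" if "t \<in> {0..T}" "s \<in> S" for t s
    proof (cases "0 < H t s")
      case True
      with \<tau>(2)[OF that(2,1)] z(2)[OF in_F[OF True that]] show ?thesis by linarith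
    qed (use Hz in linarith)
    have "0 \<le> \<epsilon> * (\<phi> z + (K + 1) * \<tau> z)"
      using \<epsilon> K pos[OF zS] \<tau>(1)[OF zS] by simp
    then have Gz: "0 < G (\<tau> z) z" using Hz by (simp add: H_def)
    then have "\<tau> z \<noteq> 0" using init[OF zS] by auto
    then have \<tau>0: "0 < \<tau> z" using \<tau>(1)[OF zS] by auto
    have "G' (\<tau> z) z \<le> \<epsilon> * K"
      using max[OF \<epsilon> \<tau>(1)[OF zS] zS Gz] all[OF \<tau>(1)[OF zS]] by (simp add: H_def algebra_simps)
    then have "G' (\<tau> z) z - \<epsilon> * (K + 1) < 0" using \<epsilon> by (simp add: algebra_simps)
    \<comment> \<open>A negative derivative at a positive time would give a larger value just before.\<close>
    from has_real_derivative_neg_dec_left[OF dH[OF \<tau>(1)[OF zS] zS] this]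
    obtain d where d: "0 < d" "\<And>h. 0 < h \<Longrightarrow> \<tau> z - h \<in> {0..T} \<Longrightarrow> h < d \<Longrightarrow> H (\<tau> z) z < H (\<tau> z - h) z"
      by blast
    define h where "h = min (d / 2) (\<tau> z)"
    have h: "0 < h" "\<tau> z - h \<in> {0..T}" "h < d" using d(1) \<tau>0 \<tau>(1)[OF zS] by (auto simp: h_def)
    with d(2)[OF h] all[OF h(2) zS] show False by linarith
  qed
  have "((\<lambda>\<epsilon>. \<epsilon> * (\<phi> s + (K + 1) * t)) \<longlongrightarrow> 0 * (\<phi> s + (K + 1) * t)) (at_right 0)"
    by (intro tendsto_intros)
  moreover have "\<forall>\<^sub>F \<epsilon> in at_right 0. G t s \<le> \<epsilon> * (\<phi> s + (K + 1) * t)"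
    using le ts by (auto intro!: eventually_at_right_less[THEN eventually_mono])
  ultimately show ?thesis
    by (intro tendsto_lowerbound[of _ 0 "at_right (0::real)"]) auto
qed

text \<open>
  The terms of Reuter's series.  Their partial sums solve \<open>L \<phi> = 1\<close> with \<open>\<phi> 0 = 0\<close>.
\<close>

definition reuter_increment :: "(nat \<Rightarrow> real) \<Rightarrow> (nat \<Rightarrow> real) \<Rightarrow> nat \<Rightarrow> real" where
  "reuter_increment lam nu x = (\<Sum>j\<le>x. (\<Prod>i\<in>{j<..x}. nu i) / (\<Prod>i\<in>{j..x}. lam i))"

definition reuter :: "(nat \<Rightarrow> real) \<Rightarrow> (nat \<Rightarrow> real) \<Rightarrow> nat \<Rightarrow> real" where
  "reuter lam nu x = (\<Sum>k<x. reuter_increment lam nu k)"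

lemma reuter_increment_Suc:
  assumes "0 < lam (Suc x)"
  shows "lam (Suc x) * reuter_increment lam nu (Suc x) = 1 + nu (Suc x) * reuter_increment lam nu x"
proof -
  have "(\<Prod>i\<in>{j<..Suc x}. nu i) / (\<Prod>i\<in>{j..Suc x}. lam i) =
      nu (Suc x) / lam (Suc x) * ((\<Prod>i\<in>{j<..x}. nu i) / (\<Prod>i\<in>{j..x}. lam i))" if "j \<le> x" for j
  proof -
    have "{j<..Suc x} = insert (Suc x) {j<..x}" "{j..Suc x} = insert (Suc x) {j..x}" using that by auto
    then show ?thesis by simp
  qed
  then have "reuter_increment lam nu (Suc x) =
      nu (Suc x) / lam (Suc x) * reuter_increment lam nu x + 1 / lam (Suc x)"
    unfolding reuter_increment_def by (simp add: sum_distrib_left)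
  then show ?thesis using assms by (simp add: field_simps)
qed

context
  fixes lam nu :: "nat \<Rightarrow> real"
  assumes irr: "bd_irreducible lam nu" and nonex: "bd_nonexplosive lam nu"
begin

lemma lam_pos: "0 < lam x" and nu_nonneg: "0 \<le> nu x" and nu_0: "nu 0 = 0"
  using irr by (cases x; auto simp: bd_irreducible_def intro: less_imp_le)+

lemma rate_pos: "0 < lam x + nu x"
  using lam_pos[of x] nu_nonneg[of x] by linarith

lemma reuter_increment_nonneg: "0 \<le> reuter_increment lam nu x"
  unfolding reuter_increment_def
  by (intro sum_nonneg divide_nonneg_nonneg prod_nonneg ballI nu_nonneg less_imp_le[OF lam_pos])

lemma reuter_nonneg: "0 \<le> reuter lam nu x"
  unfolding reuter_def by (intro sum_nonneg reuter_increment_nonneg)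

lemma reuter_generator:
  "lam x * (reuter lam nu (x + 1) - reuter lam nu x) + nu x * (reuter lam nu (x - 1) - reuter lam nu x) = 1"
proof (cases x)
  case 0
  then show ?thesis using lam_pos[of 0] by (simp add: nu_0 reuter_def reuter_increment_def)
next
  case (Suc y)
  then show ?thesis
    using reuter_increment_Suc[of lam y nu, OF lam_pos] by (simp add: reuter_def algebra_simps)
qed

text \<open>
  This is where nonexplosion enters: the divergence of Reuter's series says that the increasing
  function \<open>reuter\<close> is unbounded.
\<close>

lemma finite_reuter_le: "finite {x. reuter lam nu x \<le> C}"
proof (rule ccontr)
  assume inf: "infinite {x. reuter lam nu x \<le> C}"
  have mono: "x \<le> y \<Longrightarrow> reuter lam nu x \<le> reuter lam nu y" for x y
    unfolding reuter_def by (intro sum_mono2) (auto intro: reuter_increment_nonneg)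
  have le: "reuter lam nu x \<le> C" for x
  proof -
    from inf obtain y where "x \<le> y" "reuter lam nu y \<le> C"
      unfolding infinite_nat_iff_unbounded_le by blast
    with mono[of x y] show ?thesis by linarith
  qed
  have "(\<Sum>n<N. ennreal (reuter_increment lam nu (n + 1))) \<le> ennreal C" for N
  proof -
    have "(\<Sum>n<N. ennreal (reuter_increment lam nu (n + 1))) = ennreal (\<Sum>n<N. reuter_increment lam nu (Suc n))"
      by (simp add: reuter_increment_nonneg)
    also have "(\<Sum>n<N. reuter_increment lam nu (Suc n)) \<le> reuter lam nu (Suc N)"
      unfolding reuter_def sum.lessThan_Suc_shift by (simp add: reuter_increment_nonneg)
    also have "\<dots> \<le> C" by (rule le)
    finally show ?thesis by (simp add: ennreal_leI)
  qed
  then have "(\<Sum>n. ennreal (reuter_increment lam nu (n + 1))) \<le> ennreal C"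
    unfolding suminf_eq_SUP by (intro SUP_least)
  then show False
    using nonex unfolding bd_nonexplosive_def reuter_increment_def Let_def by (simp add: top_unique)
qed

text \<open>
  At a maximizer of \<open>G - \<epsilon> * \<phi>\<close> the generator applied to \<open>G\<close> is at most \<open>\<epsilon> * L \<phi> = \<epsilon>\<close>.
\<close>

lemma generator_at_max:
  assumes "\<And>y. G y - \<epsilon> * reuter lam nu y \<le> G x - \<epsilon> * reuter lam nu x"
  shows "lam x * G (x + 1) + nu x * G (x - 1) - (lam x + nu x) * G x \<le> \<epsilon>"
proof -
  have "lam x * (G (x + 1) - G x) + nu x * (G (x - 1) - G x) \<le>
     lam x * (\<epsilon> * (reuter lam nu (x + 1) - reuter lam nu x)) + nu x * (\<epsilon> * (reuter lam nu (x - 1) - reuter lam nu x))"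
    using assms[of "x + 1"] assms[of "x - 1"] less_imp_le[OF lam_pos] nu_nonneg
    by (intro add_mono mult_left_mono) (auto simp: algebra_simps)
  also have "\<dots> = \<epsilon> * (lam x * (reuter lam nu (x + 1) - reuter lam nu x) + nu x * (reuter lam nu (x - 1) - reuter lam nu x))"
    by (simp add: algebra_simps)
  finally show ?thesis unfolding reuter_generator by (simp add: algebra_simps)
qed

lemma semigroup_has_derivative:
  fixes f :: "nat \<Rightarrow> real"
  assumes f: "\<And>x. 0 \<le> f x" "\<And>x. f x \<le> B"
    and h_def: "\<And>t x. h t x = enn2real (fk lam nu (\<lambda>_. 0) (\<lambda>x. ennreal (f x)) t x)"
  shows "h 0 x = f x" and "0 \<le> h t x" and "h t x \<le> B"
    and "fk lam nu (\<lambda>_. 0) (\<lambda>x. ennreal (f x)) t x = ennreal (h t x)"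
    and "t \<in> {0..T} \<Longrightarrow> ((\<lambda>t. h t x) has_real_derivative
      (lam x * h t (x + 1) + nu x * h t (x - 1) - (lam x + nu x) * h t x)) (at t within {0..T})"
proof -
  have B: "0 \<le> B" using f[of 0] by linarith
  have le: "fk lam nu (\<lambda>_. 0) (\<lambda>x. ennreal (f x)) t x \<le> ennreal B" for t x
    by (intro fk_le_const ennreal_leI f)
  show "h 0 x = f x"
    by (rule fk_has_derivative(1)[where B = "\<lambda>_. B", OF less_imp_le[OF lam_pos] nu_nonneg rate_pos f(1) le h_def])
  show "0 \<le> h t x" by (simp add: h_def)
  show "h t x \<le> B" unfolding h_def by (rule enn2real_leI[OF B le])
  show "fk lam nu (\<lambda>_. 0) (\<lambda>x. ennreal (f x)) t x = ennreal (h t x)"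
    unfolding h_def using le[of t x] by (simp add: ennreal_enn2real_if top.not_eq_extremum le_less_trans)
  show "t \<in> {0..T} \<Longrightarrow> ((\<lambda>t. h t x) has_real_derivative
      (lam x * h t (x + 1) + nu x * h t (x - 1) - (lam x + nu x) * h t x)) (at t within {0..T})"
    using fk_has_derivative(2)[where B = "\<lambda>_. B", OF less_imp_le[OF lam_pos] nu_nonneg rate_pos f(1) le h_def, of t T x]
    by simp
qed

text \<open>
  The deficit \<open>1 - P t 1\<close> is a bounded solution of the backward equation that starts from 0.
\<close>

lemma semigroup_one:
  assumes "0 \<le> t"
  shows "fk lam nu (\<lambda>_. 0) (\<lambda>_. 1) t x = 1"
proof -
  define h where "h t x = enn2real (fk lam nu (\<lambda>_. 0) (\<lambda>x. ennreal 1) t x)" for t x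
  note D = semigroup_has_derivative[of "\<lambda>_. 1" 1 h, OF _ _ h_def, simplified]
  have "1 - h t x \<le> 0"
  proof (rule comparison_principle[where S = UNIV and T = t and \<phi> = "reuter lam nu" and B = 1 and K = 1
      and G' = "\<lambda>t x. - (lam x * h t (x + 1) + nu x * h t (x - 1) - (lam x + nu x) * h t x)"
      and G = "\<lambda>t x. 1 - h t x"])
    fix \<tau> y \<epsilon>
    assume "\<And>z. z \<in> UNIV \<Longrightarrow> 1 - h \<tau> z - \<epsilon> * reuter lam nu z \<le> 1 - h \<tau> y - \<epsilon> * reuter lam nu y"
    from generator_at_max[of "\<lambda>z. 1 - h \<tau> z" \<epsilon> y, OF this[OF UNIV_I]]
    show "- (lam y * h \<tau> (y + 1) + nu y * h \<tau> (y - 1) - (lam y + nu y) * h \<tau> y) \<le> \<epsilon> * 1"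
      by (simp add: algebra_simps)
  next
    fix \<tau> y
    assume "\<tau> \<in> {0..t}"
    with D(5)[of \<tau> t y] show "((\<lambda>\<tau>. 1 - h \<tau> y) has_real_derivative
       - (lam y * h \<tau> (y + 1) + nu y * h \<tau> (y - 1) - (lam y + nu y) * h \<tau> y)) (at \<tau> within {0..t})"
      by (auto intro!: derivative_eq_intros)
  qed (use assms D(1,2) finite_reuter_le reuter_nonneg in auto)
  with D(3)[of t x] have "h t x = 1" by simp
  with D(4)[of t x] show ?thesis by simp
qed

text \<open>
  The comparison principle for \<open>P t f x - P t f y\<close> on the pairs \<open>x \<le> y\<close>, with two independent
  chains in mind.  The difference vanishes on the diagonal, so at a positive maximum \<open>x < y\<close>, and
  a single jump of either component stays within the set of pairs.
\<close>

lemma semigroup_mono_bounded: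
  fixes f :: "nat \<Rightarrow> real"
  assumes f: "mono f" "\<And>x. 0 \<le> f x" "\<And>x. f x \<le> B" and t: "0 \<le> t" and xy: "x \<le> y"
  shows "fk lam nu (\<lambda>_. 0) (\<lambda>x. ennreal (f x)) t x \<le> fk lam nu (\<lambda>_. 0) (\<lambda>x. ennreal (f x)) t y"
proof -
  define h where "h t x = enn2real (fk lam nu (\<lambda>_. 0) (\<lambda>x. ennreal (f x)) t x)" for t x
  note D = semigroup_has_derivative[of f B h, OF f(2,3) h_def]
  define L where "L t x = lam x * h t (x + 1) + nu x * h t (x - 1) - (lam x + nu x) * h t x" for t x
  define S where "S = {(x, y). x \<le> (y :: nat)}"
  have "(case (x, y) of (x, y) \<Rightarrow> h t x - h t y) \<le> 0"
  proof (rule comparison_principle[where G = "\<lambda>t (x, y). h t x - h t y" and s = "(x, y)" and S = S and T = t and \<phi>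
      = "\<lambda>(x, y). reuter lam nu x + reuter lam nu y" and B = B
      and K = 2 and G' = "\<lambda>t (x, y). L t x - L t y"])
    fix C
    have "{s \<in> S. (case s of (x, y) \<Rightarrow> reuter lam nu x + reuter lam nu y) \<le> C} \<subseteq>
       {x. reuter lam nu x \<le> C} \<times> {x. reuter lam nu x \<le> C}"
    proof
      fix s assume "s \<in> {s \<in> S. (case s of (x, y) \<Rightarrow> reuter lam nu x + reuter lam nu y) \<le> C}"
      then obtain x y where "s = (x, y)" "reuter lam nu x + reuter lam nu y \<le> C" by (cases s) auto
      with reuter_nonneg[of x] reuter_nonneg[of y] show "s \<in> {x. reuter lam nu x \<le> C} \<times> {x. reuter lam nu x \<le> C}"
        by auto
    qed
    then show "finite {s \<in> S. (case s of (x, y) \<Rightarrow> reuter lam nu x + reuter lam nu y) \<le> C}"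
      by (rule finite_subset) (intro finite_cartesian_product finite_reuter_le)
  next
    fix \<tau> s assume "\<tau> \<in> {0..t}"
    with D(5)[of \<tau> t] have "((\<lambda>\<tau>. h \<tau> x - h \<tau> y) has_real_derivative L \<tau> x - L \<tau> y) (at \<tau> within {0..t})" for x y
      by (auto simp: L_def intro!: DERIV_diff)
    then show "((\<lambda>\<tau>. case s of (x, y) \<Rightarrow> h \<tau> x - h \<tau> y) has_real_derivative
       (case s of (x, y) \<Rightarrow> L \<tau> x - L \<tau> y)) (at \<tau> within {0..t})"
      by (cases s) simp
  next
    fix \<tau> s \<epsilon>
    assume \<epsilon>: "0 < \<epsilon>" and "s \<in> S" and pos: "0 < (case s of (x, y) \<Rightarrow> h \<tau> x - h \<tau> y)"
      and max: "\<And>s'. s' \<in> S \<Longrightarrow> (case s' of (x, y) \<Rightarrow> h \<tau> x - h \<tau> y) -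
          \<epsilon> * (case s' of (x, y) \<Rightarrow> reuter lam nu x + reuter lam nu y)
        \<le> (case s of (x, y) \<Rightarrow> h \<tau> x - h \<tau> y) - \<epsilon> * (case s of (x, y) \<Rightarrow> reuter lam nu x + reuter lam nu y)"
    obtain x y where s: "s = (x, y)" by (cases s)
    have xy: "x < y" using pos \<open>s \<in> S\<close> by (cases "x = y") (auto simp: s S_def)
    have m: "h \<tau> x' - h \<tau> y' - \<epsilon> * (reuter lam nu x' + reuter lam nu y') \<le>
        h \<tau> x - h \<tau> y - \<epsilon> * (reuter lam nu x + reuter lam nu y)" if "x' \<le> y'" for x' y'
      using max[of "(x', y')"] that by (simp add: S_def s)
    have "lam x * (h \<tau> (x + 1) - h \<tau> x) + nu x * (h \<tau> (x - 1) - h \<tau> x) \<le>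
     lam x * (\<epsilon> * (reuter lam nu (x + 1) - reuter lam nu x)) + nu x * (\<epsilon> * (reuter lam nu (x - 1) - reuter lam nu x))"
      using m[of "x + 1" y] m[of "x - 1" y] xy less_imp_le[OF lam_pos] nu_nonneg
      by (intro add_mono mult_left_mono) (auto simp: algebra_simps)
    moreover have "lam y * (h \<tau> y - h \<tau> (y + 1)) + nu y * (h \<tau> y - h \<tau> (y - 1)) \<le>
     lam y * (\<epsilon> * (reuter lam nu (y + 1) - reuter lam nu y)) + nu y * (\<epsilon> * (reuter lam nu (y - 1) - reuter lam nu y))"
      using m[of x "y + 1"] m[of x "y - 1"] xy less_imp_le[OF lam_pos] nu_nonneg
      by (intro add_mono mult_left_mono) (auto simp: algebra_simps)
    moreover have "lam z * (\<epsilon> * (reuter lam nu (z + 1) - reuter lam nu z))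
        + nu z * (\<epsilon> * (reuter lam nu (z - 1) - reuter lam nu z)) = \<epsilon>" for z
      using arg_cong[OF reuter_generator[of z], of "\<lambda>r. \<epsilon> * r"] by (simp add: algebra_simps)
    ultimately show "(case s of (x, y) \<Rightarrow> L \<tau> x - L \<tau> y) \<le> \<epsilon> * 2"
      by (simp add: s L_def algebra_simps)
  next
    fix \<tau> s show "(case s of (x, y) \<Rightarrow> h \<tau> x - h \<tau> y) \<le> B"
      using D(2)[of \<tau> "snd s"] D(3)[of \<tau> "fst s"] by (cases s) simp
  next
    fix s assume "s \<in> S"
    then show "(case s of (x, y) \<Rightarrow> h 0 x - h 0 y) \<le> 0"
      using f(1) by (auto simp: S_def D(1) monoD)
  next
    fix s show "0 \<le> (case s of (x, y) \<Rightarrow> reuter lam nu x + reuter lam nu y)"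
      using reuter_nonneg by (cases s) simp
  qed (use t xy in \<open>auto simp: S_def\<close>)
  then show ?thesis by (simp add: D(4) ennreal_leI)
qed

end

section \<open>Intertwining of increments with the Feynman--Kac functional\<close>

text \<open>
  The derivative at the end points is one-sided, as the backward equation holds only for
  nonnegative times.
\<close>

lemma nn_integral_FTC_at_within:
  fixes F :: "real \<Rightarrow> real"
  assumes "0 \<le> t" "0 \<le> F 0" and [measurable]: "f \<in> borel_measurable borel" and nonneg: "\<And>r. r \<in> {0..t} \<Longrightarrow> 0 \<le> f r"
    and "\<And>r. r \<in> {0..t} \<Longrightarrow> (F has_real_derivative f r) (at r within {0..t})"
  shows "ennreal (F 0) + (\<integral>\<^sup>+r. indicator {0..t} r * ennreal (f r) \<partial>lborel) = ennreal (F t)"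
proof -
  have I: "(f has_integral F t - F 0) {0..t}"
    using assms by (intro fundamental_theorem_of_calculus) (auto simp:
        has_real_derivative_iff_has_vector_derivative[symmetric])
  then have "((\<lambda>r. if r \<in> {0..t} then f r else 0) has_integral F t - F 0) UNIV"
    by (simp only: has_integral_restrict_UNIV)
  then have "(\<integral>\<^sup>+r. ennreal (if r \<in> {0..t} then f r else 0) \<partial>lborel) = ennreal (F t - F 0)"
    using nonneg by (intro nn_integral_has_integral_lborel) auto
  moreover have "0 \<le> F t - F 0" using I nonneg by (rule has_integral_nonneg)
  ultimately show ?thesis
    using \<open>0 \<le> F 0\<close>
    by (subst nn_integral_cong[of _ _ "\<lambda>r. ennreal (if r \<in> {0..t} then f r else 0)"])
       (auto simp: indicator_def ennreal_plus[symmetric] simp del: ennreal_plus)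
qed

context
  fixes lam nu u :: "nat \<Rightarrow> real"
  assumes irr: "bd_irreducible lam nu" and nonex: "bd_nonexplosive lam nu" and u_pos: "\<And>x. 0 < u x"
begin

lemma mod_birth_pos: "0 < mod_birth u lam x" and mod_death_nonneg: "0 \<le> mod_death u nu x"
  using lam_pos[OF irr nonex] nu_nonneg[OF irr nonex] u_pos
  by (auto simp: mod_birth_def mod_death_def intro!: mult_pos_pos divide_pos_pos mult_nonneg_nonneg
      divide_nonneg_nonneg less_imp_le[OF u_pos])

lemma mod_rate_pos: "0 < mod_birth u lam x + mod_death u nu x"
  using mod_birth_pos[of x] mod_death_nonneg[of x] by linarith

text \<open>
  The total rate of the modified chain plus its potential is the diagonal coefficient of the
  system solved by increments.  In this and the next two identities lies the choice of the
  modified rates and of the potential.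
\<close>

lemma potential_plus_rates:
  "potential u lam nu x + (mod_birth u lam x + mod_death u nu x) = nu (x + 1) + lam x"
  by (simp add: potential_def)

lemma mod_birth_cancel: "u x * (mod_birth u lam x * r) = lam (x + 1) * (u (x + 1) * r)"
  using u_pos[of x] by (simp add: mod_birth_def)

lemma mod_death_cancel: "u x * (mod_death u nu x * r) = nu x * (u (x - 1) * r)"
  using u_pos[of x] by (simp add: mod_death_def)

text \<open>
  Minimality bounds the Feynman--Kac functional by the increments \<open>D / u\<close>, and in particular makes
  it finite.  The remainder \<open>R\<close> is then shown to vanish by the comparison principle for its
  partial sums.
\<close>

lemma intertwining_bounded:
  fixes f :: "nat \<Rightarrow> real"
  assumes f: "mono f" "\<And>x. 0 \<le> f x" "\<And>x. f x \<le> B" and t: "0 \<le> t"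
  shows "fk lam nu (\<lambda>_. 0) (\<lambda>y. ennreal (f y)) t (x + 1) = fk lam nu (\<lambda>_. 0) (\<lambda>y. ennreal (f y)) t x +
    ennreal (u x) * fk (mod_birth u lam) (mod_death u nu) (potential u lam nu) (\<lambda>y. ennreal ((f (y + 1) - f y) / u y)) t x"
proof -
  define h where "h t x = enn2real (fk lam nu (\<lambda>_. 0) (\<lambda>x. ennreal (f x)) t x)" for t x
  note Dh = semigroup_has_derivative[OF irr nonex, of f B h, OF f(2,3) h_def]
  have [measurable]: "(\<lambda>t. h t x) \<in> borel_measurable borel" for x unfolding h_def by measurable
  define \<alpha> \<beta> V where "\<alpha> = mod_birth u lam" and "\<beta> = mod_death u nu" and "V = potential u lam nu"
  have rates: "0 \<le> \<alpha> x" "0 \<le> \<beta> x" "0 < \<alpha> x + \<beta> x" for x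
    using mod_birth_pos mod_death_nonneg mod_rate_pos by (auto simp: \<alpha>_def \<beta>_def intro: less_imp_le)
  define c where "c x = nu (x + 1) + lam x" for x
  have c: "V x + (\<alpha> x + \<beta> x) = c x" for x unfolding V_def \<alpha>_def \<beta>_def c_def by (rule potential_plus_rates)
  define g where "g y = (f (y + 1) - f y) / u y" for y
  have g0: "0 \<le> g y" for y using f(1) u_pos[of y] by (simp add: g_def monoD)
  define D where "D t x = h t (x + 1) - h t x" for t x
  have D0: "0 \<le> D t x" if "0 \<le> t" for t x
    using semigroup_mono_bounded[OF irr nonex f that, of x "x + 1"] Dh(2) by (simp add: Dh(4) D_def)
  have dD: "((\<lambda>t. D t x) has_real_derivative lam (x + 1) * D t (x + 1) + nu x * D t (x - 1) - c x * D t x)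
      (at t within {0..T})"
    if "t \<in> {0..T}" for t x T
    unfolding D_def
    by (rule DERIV_cong[OF DERIV_diff[OF Dh(5)[OF that] Dh(5)[OF that]]])
       (cases x; simp add: c_def nu_0[OF irr nonex] algebra_simps)
  \<comment> \<open>\<open>D / u\<close> solves the backward equation of the functional, and is nonnegative by monotonicity.\<close>
  have le: "fk \<alpha> \<beta> V (\<lambda>y. ennreal (g y)) t x \<le> ennreal (D t x / u x)" if t: "0 \<le> t" for t x
  proof (rule fk_minimal[of \<alpha> \<beta> _ V "\<lambda>t x. ennreal (D t x / u x)" t x, OF rates _ t])
    fix t :: real and x assume t: "0 \<le> t"
    define \<psi> where "\<psi> r = exp (c x * r) * (\<alpha> x * (D r (x + 1) / u (x + 1)) + \<beta> x * (D r (x - 1) / u (x - 1)))" for r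
    have u\<psi>: "\<psi> r = exp (c x * r) * (lam (x + 1) * D r (x + 1) + nu x * D r (x - 1)) / u x" for r
      using u_pos[of x] u_pos[of "x + 1"] u_pos[of "x - 1"]
      unfolding \<psi>_def \<alpha>_def \<beta>_def mod_birth_def mod_death_def
      by (simp add: field_simps)
    have [measurable]: "\<psi> \<in> borel_measurable borel" unfolding \<psi>_def D_def by measurable
    have \<psi>0: "0 \<le> \<psi> r" if "0 \<le> r" for r
      unfolding \<psi>_def using rates D0[OF that] u_pos
      by (intro mult_nonneg_nonneg add_nonneg_nonneg divide_nonneg_pos) auto
    have g_eq: "g x = exp (c x * 0) * D 0 x / u x" by (simp add: D_def Dh(1) g_def)
    have "ennreal (g x) + (\<integral>\<^sup>+r. indicator {0..t} r * (ennreal (exp ((V x + (\<alpha> x + \<beta> x)) * r)) *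
        (ennreal (\<alpha> x) * ennreal (D r (x + 1) / u (x + 1)) + ennreal (\<beta> x) * ennreal (D r (x - 1) / u (x - 1)))) \<partial>lborel) =
        ennreal (g x) + (\<integral>\<^sup>+r. indicator {0..t} r * ennreal (\<psi> r) \<partial>lborel)"
      unfolding c \<psi>_def using rates D0 u_pos
      by (intro arg_cong2[where f = "(+)"] refl nn_integral_cong)
         (auto simp: indicator_def ennreal_mult less_imp_le divide_nonneg_pos simp del: times_divide_eq_right)
    also have "\<dots> = ennreal (exp (c x * t) * D t x / u x)"
      unfolding g_eq
    proof (rule nn_integral_FTC_at_within[OF t])
      show "0 \<le> exp (c x * 0) * D 0 x / u x" using g0[of x] by (simp only: g_eq)
      fix r assume r: "r \<in> {0..t}"
      have "((\<lambda>t. exp (c x * t) * D t x) has_real_derivative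
          exp (c x * r) * (lam (x + 1) * D r (x + 1) + nu x * D r (x - 1))) (at r within {0..t})"
        by (auto intro!: derivative_eq_intros dD[OF r] simp: algebra_simps)
      then show "((\<lambda>t. exp (c x * t) * D t x / u x) has_real_derivative \<psi> r) (at r within {0..t})"
        unfolding u\<psi> by (rule DERIV_cdivide)
    qed (auto intro: \<psi>0)
    also have "\<dots> = ennreal (exp ((V x + (\<alpha> x + \<beta> x)) * t)) * ennreal (D t x / u x)"
      unfolding c using D0[OF t] u_pos[of x] by (simp add: ennreal_mult[symmetric] divide_nonneg_pos)
    finally show "ennreal (g x) + (\<integral>\<^sup>+r. indicator {0..t} r * (ennreal (exp ((V x + (\<alpha> x + \<beta> x)) * r)) *
        (ennreal (\<alpha> x) * ennreal (D r (x + 1) / u (x + 1)) + ennreal (\<beta> x) * ennreal (D r (x - 1) / u (x - 1)))) \<partial>lborel)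
        \<le> ennreal (exp ((V x + (\<alpha> x + \<beta> x)) * t)) * ennreal (D t x / u x)"
      by simp
  qed
  define k where "k t x = enn2real (fk \<alpha> \<beta> V (\<lambda>y. ennreal (g y)) t x)" for t x
  have leB: "fk \<alpha> \<beta> V (\<lambda>y. ennreal (g y)) t x \<le> ennreal (B / u x)" if t: "0 \<le> t" for t x
    using Dh(2)[of t x] Dh(3)[of t "x + 1"] u_pos[of x]
    by (intro order_trans[OF le[OF t]] ennreal_leI divide_right_mono) (auto simp: D_def)
  note Dk = fk_has_derivative[of \<alpha> \<beta> g V "\<lambda>x. B / u x" k, OF rates g0 leB k_def]
  have fk_k: "fk \<alpha> \<beta> V (\<lambda>y. ennreal (g y)) t x = ennreal (k t x)" if "0 \<le> t" for t x
    unfolding k_def using leB[OF that, of x] by (simp add: ennreal_enn2real_if top.not_eq_extremum le_less_trans)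
  have k0: "0 \<le> k t x" for t x by (simp add: k_def)
  define R where "R t x = D t x - u x * k t x" for t x
  have R0: "0 \<le> R t x" if "0 \<le> t" for t x
    using le[OF that, of x] u_pos[of x] D0[OF that, of x]
    by (auto simp: fk_k[OF that] R_def divide_nonneg_pos pos_le_divide_eq mult.commute)
  have dR: "((\<lambda>t. R t x) has_real_derivative lam (x + 1) * R t (x + 1) + nu x * R t (x - 1) - c x * R t x)
      (at t within {0..T})"
    if "t \<in> {0..T}" for t x T
  proof -
    have "((\<lambda>t. u x * k t x) has_real_derivative u x * (\<alpha> x * k t (x + 1) + \<beta> x * k t (x - 1) - (V x + (\<alpha> x
        + \<beta> x)) * k t x)) (at t within {0..T})"
      by (intro DERIV_cmult Dk(2) that)
    also have "u x * (\<alpha> x * k t (x + 1) + \<beta> x * k t (x - 1) - (V x + (\<alpha> x + \<beta> x)) * k t x) =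
       lam (x + 1) * (u (x + 1) * k t (x + 1)) + nu x * (u (x - 1) * k t (x - 1)) - c x * (u x * k t x)"
      unfolding c unfolding right_diff_distrib distrib_left \<alpha>_def \<beta>_def mod_birth_cancel mod_death_cancel by simp
    finally show ?thesis
      unfolding R_def by (rule DERIV_cong[OF DERIV_diff[OF dD[OF that]]]) (simp add: algebra_simps)
  qed
  define W where "W t x = (\<Sum>y<x. R t y)" for t x
  have W0: "0 \<le> W t x" if "0 \<le> t" for t x unfolding W_def by (intro sum_nonneg R0 that)
  \<comment> \<open>Telescoping: \<open>W t x\<close> is at most \<open>P t f x - P t f 0\<close>.\<close>
  have WB: "W t x \<le> B" for t x
  proof -
    have "W t x = h t x - h t 0 - (\<Sum>y<x. u y * k t y)"
      by (induction x) (auto simp: W_def R_def D_def)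
    moreover have "0 \<le> (\<Sum>y<x. u y * k t y)" by (intro sum_nonneg mult_nonneg_nonneg k0 less_imp_le[OF u_pos])
    ultimately show ?thesis using Dh(2)[of t 0] Dh(3)[of t x] by linarith
  qed
  \<comment> \<open>The partial sums turn the system for increments back into the generator of the chain; the
    boundary term at 0 has a favourable sign.\<close>
  have sumR: "(\<Sum>y<x. lam (y + 1) * R t (y + 1) + nu y * R t (y - 1) - c y * R t y) =
     lam x * W t (x + 1) + nu x * W t (x - 1) - (lam x + nu x) * W t x - lam 0 * R t 0" for t x
  proof -
    have "(\<Sum>y<x. lam (y + 1) * R t (y + 1) + nu y * R t (y - 1) - c y * R t y) =
      lam x * R t x - nu x * R t (x - 1) - lam 0 * R t 0"
      by (induction x) (auto simp: c_def nu_0[OF irr nonex] algebra_simps)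
    also have "\<dots> = lam x * W t (x + 1) + nu x * W t (x - 1) - (lam x + nu x) * W t x - lam 0 * R t 0"
      by (cases x) (auto simp: W_def nu_0[OF irr nonex] algebra_simps)
    finally show ?thesis .
  qed
  have "W t (x + 1) \<le> 0"
  proof (rule comparison_principle[where S = UNIV and T = t and \<phi> = "reuter lam nu" and B = B and K = 1 and G = W
      and G' = "\<lambda>t x. \<Sum>y<x. lam (y + 1) * R t (y + 1) + nu y * R t (y - 1) - c y * R t y"])
    fix \<tau> y \<epsilon>
    assume \<tau>: "\<tau> \<in> {0..t}" and "\<And>z. z \<in> UNIV \<Longrightarrow> W \<tau> z - \<epsilon> * reuter lam nu z \<le> W \<tau> y - \<epsilon> * reuter lam nu y"
    from generator_at_max[OF irr nonex, of "W \<tau>" \<epsilon> y, OF this(2)[OF UNIV_I]]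
    have "lam y * W \<tau> (y + 1) + nu y * W \<tau> (y - 1) - (lam y + nu y) * W \<tau> y \<le> \<epsilon>" .
    moreover have "0 \<le> lam 0 * R \<tau> 0" using R0[of \<tau> 0] \<tau> lam_pos[OF irr nonex, of 0] by simp
    ultimately show "(\<Sum>y<y. lam (y + 1) * R \<tau> (y + 1) + nu y * R \<tau> (y - 1) - c y * R \<tau> y) \<le> \<epsilon> * 1"
      unfolding sumR by simp
  next
    fix \<tau> y
    assume "\<tau> \<in> {0..t}"
    then show "((\<lambda>\<tau>. W \<tau> y) has_real_derivative (\<Sum>y<y. lam (y + 1) * R \<tau> (y + 1)
        + nu y * R \<tau> (y - 1) - c y * R \<tau> y)) (at \<tau> within {0..t})"
      unfolding W_def by (intro DERIV_sum dR)
  next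
    fix y show "W 0 y \<le> 0"
      using u_pos by (intro eq_refl) (simp add: W_def R_def D_def Dh(1) Dk(1) g_def less_imp_neq[symmetric])
  next
    fix y show "0 \<le> reuter lam nu y" by (rule reuter_nonneg[OF irr nonex])
  next
    fix C show "finite {s \<in> UNIV. reuter lam nu s \<le> C}" using finite_reuter_le[OF irr nonex, of C] by simp
  qed (use t WB in auto)
  moreover have "W t (x + 1) = W t x + R t x" by (simp add: W_def)
  ultimately have "R t x = 0" using W0[OF t, of x] R0[OF t, of x] by linarith
  then have "h t (x + 1) = h t x + u x * k t x" by (simp add: R_def D_def)
  then show ?thesis
    using fk_k[OF t, of x] k0[of t x] Dh(2)[of t x] u_pos[of x]
    unfolding \<alpha>_def \<beta>_def V_def g_def Dh(4) by (simp add: ennreal_mult less_imp_le)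
qed

text \<open>
  Freezing \<open>f\<close> beyond \<open>N\<close> keeps it increasing and makes it bounded; both \<open>f\<close> and its increments are
  approximated from below, and monotone convergence applies on either side of the identity.
\<close>

lemma intertwining:
  fixes f :: "nat \<Rightarrow> real"
  assumes f: "mono f" "\<And>x. 0 \<le> f x" and t: "0 \<le> t"
  shows "fk lam nu (\<lambda>_. 0) (\<lambda>y. ennreal (f y)) t (x + 1) = fk lam nu (\<lambda>_. 0) (\<lambda>y. ennreal (f y)) t x +
    ennreal (u x) * fk (mod_birth u lam) (mod_death u nu) (potential u lam nu) (\<lambda>y. ennreal ((f (y + 1) - f y) / u y)) t x"
proof -
  define fN where "fN N y = f (min y N)" for N y
  define gN where "gN N y = (fN N (y + 1) - fN N y) / u y" for N y
  have fN: "mono (fN N)" "0 \<le> fN N y" "fN N y \<le> f N" for N y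
    using f by (auto simp: fN_def mono_def)
  have 1: "(\<lambda>N. fk lam nu (\<lambda>_. 0) (\<lambda>y. ennreal (fN N y)) t x) \<longlonglongrightarrow> fk lam nu (\<lambda>_. 0) (\<lambda>y. ennreal (f y)) t x" for x
  proof (rule fk_monotone_convergence)
    show "incseq (\<lambda>N y. ennreal (fN N y))"
      using f(1) by (intro incseq_SucI le_funI ennreal_leI) (auto simp: fN_def intro!: monoD[OF f(1)])
    show "(\<lambda>N. ennreal (fN N y)) \<longlonglongrightarrow> ennreal (f y)" for y
      by (rule tendsto_eventually, rule eventually_mono[OF eventually_ge_at_top[of y]]) (simp add: fN_def min_def)
  qed
  have gN: "gN N y = (if y < N then (f (y + 1) - f y) / u y else 0)" for N y
    by (auto simp: gN_def fN_def min_def)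
  have 2: "(\<lambda>N. fk (mod_birth u lam) (mod_death u nu) (potential u lam nu) (\<lambda>y. ennreal (gN N y)) t x) \<longlonglongrightarrow>
     fk (mod_birth u lam) (mod_death u nu) (potential u lam nu) (\<lambda>y. ennreal ((f (y + 1) - f y) / u y)) t x"
  proof (rule fk_monotone_convergence)
    show "incseq (\<lambda>N y. ennreal (gN N y))"
      by (intro incseq_SucI le_funI) (auto simp: gN)
    show "(\<lambda>N. ennreal (gN N y)) \<longlonglongrightarrow> ennreal ((f (y + 1) - f y) / u y)" for y
      by (rule tendsto_eventually, rule eventually_mono[OF eventually_gt_at_top[of y]]) (simp add: gN)
  qed
  show ?thesis
  proof (rule LIMSEQ_unique[OF 1])
    show "(\<lambda>N. fk lam nu (\<lambda>_. 0) (\<lambda>y. ennreal (fN N y)) t (x + 1)) \<longlonglongrightarrow> fk lam nu (\<lambda>_. 0) (\<lambda>y. ennreal (f y)) t x +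
      ennreal (u x) * fk (mod_birth u lam) (mod_death u nu) (potential u lam nu) (\<lambda>y. ennreal ((f (y
          + 1) - f y) / u y)) t x"
      unfolding intertwining_bounded[OF fN t] gN_def[symmetric]
      by (intro tendsto_add 1 ennreal_tendsto_cmult 2) simp
  qed
qed

end

section \<open>Lipschitz norms and the optimal rate\<close>

text \<open>
  The distance is additive along the integers, so neighbouring states determine the Lipschitz norm.
\<close>

lemma lip_norm_increments:
  fixes rho u g :: "nat \<Rightarrow> real"
  assumes u_def: "\<And>x. u x = rho (x + 1) - rho x" and u_pos: "\<And>x. 0 < u x"
    and d: "\<And>x y. d x y = \<bar>rho x - rho y\<bar>"
  shows "lip_norm d g = (SUP x. ennreal (\<bar>g (x + 1) - g x\<bar> / u x))" (is "_ = ?S")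
proof (rule antisym)
  have d_Suc: "d (x + 1) x = u x" for x using u_def[of x] u_pos[of x] by (simp add: d)
  show "?S \<le> lip_norm d g"
    unfolding lip_norm_def
  proof (rule SUP_least)
    fix x :: nat
    have "(x + 1, x) \<in> {(x, y). x \<noteq> y}" by simp
    from SUP_upper[OF this, of "\<lambda>(x, y). ennreal (\<bar>g x - g y\<bar> / d x y)"]
    show "ennreal (\<bar>g (x + 1) - g x\<bar> / u x) \<le> (SUP (x, y) \<in> {(x, y). x \<noteq> y}. ennreal (\<bar>g x - g y\<bar> / d x y))"
      by (simp only: prod.case d_Suc)
  qed
  show "lip_norm d g \<le> ?S"
  proof (cases "?S = \<top>")
    case False
    define L where "L = enn2real ?S"
    have S: "?S = ennreal L" unfolding L_def
      using False by (intro ennreal_enn2real[symmetric]) (simp only: top.not_eq_extremum)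
    have L0: "0 \<le> L" by (simp add: L_def)
    have inc: "\<bar>g (x + 1) - g x\<bar> \<le> L * (rho (x + 1) - rho x)" for x
    proof -
      have "ennreal (\<bar>g (x + 1) - g x\<bar> / u x) \<le> ennreal L" unfolding S[symmetric] by (rule SUP_upper) simp
      then show ?thesis using L0 u_pos[of x] by (simp add: pos_divide_le_eq u_def)
    qed
    have lt: "x \<le> y \<Longrightarrow> \<bar>g y - g x\<bar> \<le> L * (rho y - rho x)" for x y
    proof (induction y rule: dec_induct)
      case (step y)
      with inc[of y] show ?case by (simp add: algebra_simps)
    qed simp
    have "ennreal (\<bar>g x - g y\<bar> / d x y) \<le> ennreal L" if "x \<noteq> y" for x y
    proof -
      have "\<bar>g x - g y\<bar> \<le> L * d x y"
      proof (cases "x \<le> y")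
        case True
        then have "L * (rho y - rho x) \<le> L * d x y" using L0 by (intro mult_left_mono) (auto simp: d)
        with lt[OF True] show ?thesis by (simp add: abs_minus_commute)
      next
        case False
        then have "L * (rho x - rho y) \<le> L * d x y" using L0 by (intro mult_left_mono) (auto simp: d)
        with lt[of y x] False show ?thesis by simp
      qed
      then show ?thesis
        using L0 by (cases "d x y = 0") (auto simp: d pos_divide_le_eq intro!: ennreal_leI)
    qed
    then show ?thesis unfolding S lip_norm_def by (intro SUP_least) auto
  next
    case True
    show ?thesis unfolding True by (rule top_greatest)
  qed
qed

lemma bd_semigroup_nn_eq_suminf:
  "bd_semigroup_nn a b t g x = (\<Sum>y. g y * ennreal (bd_prob a b t x y))"
proof -
  interpret prob_space bd_noise by (rule prob_space_bd_noise)
  let ?A = "\<lambda>y. {\<omega> \<in> space bd_noise. bd_process a b x t \<omega> = Some y}"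
  have A[measurable]: "?A y \<in> sets bd_noise" for y by measurable
  have "eval0 g (bd_process a b x t \<omega>) = (\<Sum>y. g y * indicator (?A y) \<omega>)" for \<omega>
  proof (cases "bd_process a b x t \<omega>")
    case (Some z)
    have "(\<Sum>y. g y * indicator (?A y) \<omega>) = (\<Sum>y\<in>{z}. g y * indicator (?A y) \<omega>)"
      using Some by (intro suminf_finite) auto
    with Some show ?thesis by (simp add: eval0_def)
  qed (simp add: eval0_def)
  then have "bd_semigroup_nn a b t g x = (\<integral>\<^sup>+\<omega>. (\<Sum>y. g y * indicator (?A y) \<omega>) \<partial>bd_noise)"
    by (simp add: bd_semigroup_nn_def)
  also have "\<dots> = (\<Sum>y. \<integral>\<^sup>+\<omega>. g y * indicator (?A y) \<omega> \<partial>bd_noise)"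
    by (rule nn_integral_suminf) measurable
  also have "\<dots> = (\<Sum>y. g y * ennreal (bd_prob a b t x y))"
    unfolding nn_integral_cmult_indicator[OF A] by (simp only: emeasure_eq_measure bd_prob_def)
  finally show ?thesis .
qed

lemma ennreal_eval0: "ennreal (eval0 f z) = eval0 (\<lambda>y. ennreal (f y)) z"
  by (simp add: eval0_def split: option.split)

lemma nn_integral_eval0: "(\<integral>\<^sup>+\<omega>. ennreal (eval0 f (bd_process a b x t \<omega>)) \<partial>bd_noise)
    = fk a b (\<lambda>_. 0) (\<lambda>y. ennreal (f y)) t x"
  unfolding ennreal_eval0 by (simp add: bd_semigroup_nn_eq_fk[symmetric] bd_semigroup_nn_def)

lemma bd_semigroup_nonneg_eq:
  assumes "\<And>y. 0 \<le> f y"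
  shows "bd_semigroup a b t f x = enn2real (fk a b (\<lambda>_. 0) (\<lambda>y. ennreal (f y)) t x)"
  unfolding bd_semigroup_def nn_integral_eval0[symmetric]
  using assms by (intro integral_eq_nn_integral AE_I2) (auto simp: eval0_def split: option.split)

lemma fk_one_le_exp:
  assumes V: "\<And>y. \<sigma> \<le> V y" and t: "0 \<le> t"
  shows "fk a b V (\<lambda>_. 1) t x \<le> ennreal (exp (- \<sigma> * t))"
proof -
  interpret prob_space bd_noise by (rule prob_space_bd_noise)
  have "fk_path a b V (\<lambda>_. 1) x t \<omega> \<le> ennreal (exp (- \<sigma> * t))" for \<omega>
  proof (cases "bd_process a b x t \<omega>")
    case (Some y)
    then have I: "set_integrable lborel {0..t} (\<lambda>s. eval0 V (bd_process a b x s \<omega>))"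
      by (intro integrable_path) simp
    have "\<sigma> * t = (LBINT s:{0..t}. \<sigma>)" using t by (simp add: set_lebesgue_integral_def)
    also have "\<dots> \<le> (LBINT s:{0..t}. eval0 V (bd_process a b x s \<omega>))"
    proof (rule set_integral_mono[OF _ I])
      show "set_integrable lborel {0..t} (\<lambda>_. \<sigma>)"
        unfolding set_integrable_def by (auto intro!: integrable_real_indicator simp: emeasure_lborel_Icc_eq)
      fix s assume "s \<in> {0..t}"
      then have "\<exists>n. bd_process a b x s \<omega> = Some (bd_jump_chain a b x \<omega> n)"
        using bd_process_before[of a b x t \<omega> s] Some by auto
      with V show "\<sigma> \<le> eval0 V (bd_process a b x s \<omega>)" by (auto simp: eval0_def)
    qed
    finally show ?thesis using Some by (simp add: fk_path_def eval0_def ennreal_leI)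
  qed (simp add: fk_path_def eval0_def)
  then have "fk a b V (\<lambda>_. 1) t x \<le> (\<integral>\<^sup>+\<omega>. ennreal (exp (- \<sigma> * t)) \<partial>bd_noise)"
    unfolding fk_def by (intro nn_integral_mono) auto
  then show ?thesis using emeasure_space_1 by simp
qed

text \<open>
  Paths from a neighbour \<open>y\<close> of \<open>x\<close> without any jump contribute \<open>exp (- (V y + a y + b y) * t)\<close>.
  Inserting this into the backward equation at \<open>x\<close> gives a lower bound whose value at time 0 is 1
  and whose derivative there is \<open>- V x\<close>.  A bound by \<open>exp (- \<sigma> * t)\<close> with \<open>\<sigma> > V x\<close> would decay faster.
\<close>

lemma fk_one_decay_le_potential:
  fixes V :: "nat \<Rightarrow> real"
  assumes rates: "\<And>x. 0 \<le> a x" "\<And>x. 0 \<le> b x" "\<And>x. 0 < a x + b x"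
    and decay: "\<And>t. 0 \<le> t \<Longrightarrow> fk a b V (\<lambda>_. 1) t x \<le> ennreal (exp (- \<sigma> * t))"
  shows "\<sigma> \<le> V x"
proof (rule ccontr)
  define c where "c y = V y + (a y + b y)" for y
  define M where "M = \<bar>c x\<bar> + \<bar>c (x + 1)\<bar> + \<bar>c (x - 1)\<bar>"
  define q where "q = a x + b x"
  have eq: "ennreal (exp (c y * t)) * fk a b V (\<lambda>_. 1) t y = 1 +
     (\<integral>\<^sup>+r. indicator {0..t} r * (ennreal (exp (c y * r)) *
        (ennreal (a y) * fk a b V (\<lambda>_. 1) r (y + 1) + ennreal (b y) * fk a b V (\<lambda>_. 1) r (y - 1))) \<partial>lborel)" if "0
            \<le> t" for t y
    unfolding c_def by (rule fk_equation[OF that rates])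
  have lower: "ennreal (exp (- c y * t)) \<le> fk a b V (\<lambda>_. 1) t y" if t: "0 \<le> t" for t y
  proof -
    have "ennreal (exp (- c y * t)) * 1 \<le> ennreal (exp (- c y * t)) * (ennreal (exp (c y * t)) * fk a b V (\<lambda>_. 1) t y)"
      unfolding eq[OF t] by (intro mult_left_mono) auto
    then show ?thesis by (simp add: mult.assoc[symmetric] ennreal_mult[symmetric] exp_add[symmetric])
  qed
  define F where "F t = exp ((c x - \<sigma>) * t) - 1 - t * (q * exp (- M * t))" for t
  have F: "0 \<le> F t" if t: "0 \<le> t" for t
  proof -
    have "ennreal (1 + t * (q * exp (- M * t))) = 1 + (\<integral>\<^sup>+r. indicator {0..t} r * ennreal (q * exp (- M * t)) \<partial>lborel)"
      using t rates(3)[of x] by (simp add: nn_integral_multc ennreal_mult q_def less_imp_le)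
    also have "\<dots> \<le> 1 + (\<integral>\<^sup>+r. indicator {0..t} r * (ennreal (exp (c x * r)) *
        (ennreal (a x) * fk a b V (\<lambda>_. 1) r (x + 1) + ennreal (b x) * fk a b V (\<lambda>_. 1) r (x - 1))) \<partial>lborel)"
    proof (intro add_left_mono nn_integral_mono)
      fix r
      show "indicator {0..t} r * ennreal (q * exp (- M * t)) \<le> indicator {0..t} r * (ennreal (exp (c x * r)) *
        (ennreal (a x) * fk a b V (\<lambda>_. 1) r (x + 1) + ennreal (b x) * fk a b V (\<lambda>_. 1) r (x - 1)))"
      proof (cases "r \<in> {0..t}")
        case True
        have bd: "exp (- M * t) \<le> exp (c x * r) * exp (- c y * r)" if "y = x + 1 \<or> y = x - 1" for y
        proof -
          have "\<bar>c x - c y\<bar> \<le> M" using that by (auto simp: M_def)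
          then have "\<bar>c x - c y\<bar> * r \<le> M * t" using True by (intro mult_mono) auto
          moreover have "- (\<bar>c x - c y\<bar> * r) \<le> (c x - c y) * r"
            using True abs_ge_minus_self[of "c x - c y"] mult_right_mono[of "- (c x - c y)" "\<bar>c x - c y\<bar>" r]
            by (simp add: left_diff_distrib)
          ultimately show ?thesis by (simp add: exp_add[symmetric] algebra_simps)
        qed
        have "ennreal (q * exp (- M * t)) = ennreal (a x * exp (- M * t) + b x * exp (- M * t))"
          by (simp add: q_def distrib_right)
        also have "\<dots> \<le> ennreal (a x * (exp (c x * r) * exp (- c (x + 1) * r))
            + b x * (exp (c x * r) * exp (- c (x - 1) * r)))"
          by (intro ennreal_leI add_mono mult_left_mono bd rates) auto
        also have "\<dots> = ennreal (exp (c x * r)) * (ennreal (a x) * ennreal (exp (- c (x + 1) * r))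
            + ennreal (b x) * ennreal (exp (- c (x - 1) * r)))"
          using rates by (simp add: ennreal_mult[symmetric] ennreal_plus[symmetric] algebra_simps del: ennreal_plus)
        also have "\<dots> \<le> ennreal (exp (c x * r)) *
          (ennreal (a x) * fk a b V (\<lambda>_. 1) r (x + 1) + ennreal (b x) * fk a b V (\<lambda>_. 1) r (x - 1))"
          using True by (intro mult_left_mono add_mono lower) auto
        finally show ?thesis using True by simp
      qed simp
    qed
    also have "\<dots> = ennreal (exp (c x * t)) * fk a b V (\<lambda>_. 1) t x" by (rule eq[OF t, symmetric])
    also have "\<dots> \<le> ennreal (exp (c x * t)) * ennreal (exp (- \<sigma> * t))"
      by (intro mult_left_mono decay t) simp
    also have "\<dots> = ennreal (exp ((c x - \<sigma>) * t))"
      by (simp add: ennreal_mult[symmetric] exp_add[symmetric] algebra_simps)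
    finally show ?thesis by (simp add: F_def)
  qed
  assume "\<not> \<sigma> \<le> V x"
  then have neg: "c x - \<sigma> - q < 0" by (simp add: c_def q_def)
  have "(F has_real_derivative c x - \<sigma> - q) (at 0)"
    unfolding F_def by (auto intro!: derivative_eq_intros)
  from DERIV_neg_dec_right[OF this neg] obtain e where "0 < e" "\<And>h. 0 < h \<Longrightarrow> h < e \<Longrightarrow> F (0 + h) < F 0" by blast
  from this(2)[of "e / 2"] \<open>0 < e\<close> F[of "e / 2"] show False by (simp add: F_def)
qed

text \<open>
  The integrability of distances makes \<open>P t rho\<close> finite, so that its values can be subtracted.
  For a 1-Lipschitz \<open>f\<close> the functions \<open>rho + f + C\<close> and \<open>rho - f + C\<close> are increasing and, for large
  \<open>C\<close>, nonnegative, and \<open>P t\<close> maps the constant \<open>C\<close> to itself; so both \<open>\<partial>(P t f)\<close> and its negative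
  are at most \<open>\<partial>(P t rho)\<close>.
\<close>

lemma lip_norm_semigroup:
  fixes lam nu rho u :: "nat \<Rightarrow> real" and d :: "nat \<Rightarrow> nat \<Rightarrow> real"
  assumes irr: "bd_irreducible lam nu" and nonex: "bd_nonexplosive lam nu"
    and rho_pos: "\<And>x. 0 < rho x"
    and u_def: "\<And>x. u x = rho (x + 1) - rho x"
    and u_pos: "\<And>x. 0 < u x"
    and d_def: "\<And>x y. d x y = \<bar>rho x - rho y\<bar>"
    and summ: "\<And>x x0. summable (\<lambda>y. d y x0 * bd_prob lam nu t x y)"
    and t: "0 \<le> t"
  shows "lip_op_norm d (bd_semigroup lam nu t) = lip_norm d (bd_semigroup lam nu t rho)"
    and "lip_norm d (bd_semigroup lam nu t rho) =
              (SUP x. feynman_kac (mod_birth u lam) (mod_death u nu) (potential u lam nu) t x)"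
proof -
  interpret prob_space bd_noise by (rule prob_space_bd_noise)
  let ?X = "bd_process lam nu" and ?T = "bd_semigroup lam nu t"
  let ?P = "\<lambda>f x. fk lam nu (\<lambda>_. 0) (\<lambda>y. ennreal (f y)) t x"
  let ?K = "feynman_kac (mod_birth u lam) (mod_death u nu) (potential u lam nu) t"
  note lip = lip_norm_increments[of u rho d, OF u_def u_pos d_def]
  have rho_mono: "mono rho"
    using u_def u_pos by (intro incseq_SucI) (metis Suc_eq_plus1 diff_gt_0_iff_gt less_imp_le)
  have one: "?P (\<lambda>_. C) x = ennreal C" if "0 \<le> C" for C x
  proof -
    have "?P (\<lambda>_. C) x = (\<integral>\<^sup>+\<omega>. ennreal C * eval0 (\<lambda>_. 1) (?X x t \<omega>) \<partial>bd_noise)"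
      unfolding nn_integral_eval0[symmetric] ennreal_eval0
      by (intro nn_integral_cong) (simp add: eval0_def split: option.split)
    also have "\<dots> = ennreal C * (\<integral>\<^sup>+\<omega>. eval0 (\<lambda>_. 1) (?X x t \<omega>) \<partial>bd_noise)"
      by (rule nn_integral_cmult) measurable
    also have "(\<integral>\<^sup>+\<omega>. eval0 (\<lambda>_. 1) (?X x t \<omega>) \<partial>bd_noise) = 1"
      using semigroup_one[OF irr nonex t, of x] by (simp add: bd_semigroup_nn_eq_fk[symmetric] bd_semigroup_nn_def)
    finally show ?thesis by simp
  qed
  have finite: "?P rho x < \<infinity>" for x
  proof -
    have "?P rho x \<le> (\<integral>\<^sup>+\<omega>. ennreal (eval0 (\<lambda>y. d y 0) (?X x t \<omega>)) + ennreal (rho 0) \<partial>bd_noise)"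
      unfolding nn_integral_eval0[symmetric]
    proof (intro nn_integral_mono)
      fix \<omega>
      have "eval0 rho z \<le> eval0 (\<lambda>y. d y 0) z + rho 0" "0 \<le> eval0 (\<lambda>y. d y 0) z" for z
        using rho_pos[of 0] by (auto simp: eval0_def d_def split: option.split)
      then show "ennreal (eval0 rho (?X x t \<omega>)) \<le> ennreal (eval0 (\<lambda>y. d y 0) (?X x t \<omega>)) + ennreal (rho 0)"
        using rho_pos[of 0] by (simp add: ennreal_plus[symmetric] ennreal_leI del: ennreal_plus)
    qed
    also have "\<dots> = (\<integral>\<^sup>+\<omega>. ennreal (eval0 (\<lambda>y. d y 0) (?X x t \<omega>)) \<partial>bd_noise) + ennreal (rho 0)"
      by (subst nn_integral_add) (use emeasure_space_1 in auto)
    also have "(\<integral>\<^sup>+\<omega>. ennreal (eval0 (\<lambda>y. d y 0) (?X x t \<omega>)) \<partial>bd_noise)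
        = (\<Sum>y. ennreal (d y 0) * ennreal (bd_prob lam nu t x y))"
      unfolding bd_semigroup_nn_eq_suminf[symmetric] ennreal_eval0 bd_semigroup_nn_def ..
    also have "\<dots> = ennreal (\<Sum>y. d y 0 * bd_prob lam nu t x y)"
      using summ[of 0 x] by (subst suminf_ennreal2[symmetric]) (auto simp: ennreal_mult d_def bd_prob_def)
    also have "\<dots> + ennreal (rho 0) < \<infinity>" by simp
    finally show ?thesis .
  qed
  have int: "integrable bd_noise (\<lambda>\<omega>. eval0 f (?X x t \<omega>))" if "\<And>y. \<bar>f y\<bar> \<le> C + rho y" for f C x
  proof (rule Bochner_Integration.integrable_bound)
    have 1: "integrable bd_noise (\<lambda>\<omega>. eval0 rho (?X x t \<omega>))"
    proof (rule integrableI_nonneg)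
      show "AE \<omega> in bd_noise. 0 \<le> eval0 rho (?X x t \<omega>)"
        using rho_pos by (auto simp: eval0_def less_imp_le split: option.split)
    qed (use finite[of x] in \<open>auto simp: nn_integral_eval0\<close>)
    then show "integrable bd_noise (\<lambda>\<omega>. \<bar>C\<bar> + eval0 rho (?X x t \<omega>))" by simp
    have "\<bar>eval0 f z\<bar> \<le> \<bar>\<bar>C\<bar> + eval0 rho z\<bar>" for z
    proof (cases z)
      case (Some y)
      then show ?thesis using that[of y] rho_pos[of y] by (simp add: eval0_def)
    qed (simp add: eval0_def)
    then show "AE \<omega> in bd_noise. norm (eval0 f (?X x t \<omega>)) \<le> norm (\<bar>C\<bar> + eval0 rho (?X x t \<omega>))" by simp
  qed measurable
  have rho_int: "integrable bd_noise (\<lambda>\<omega>. eval0 rho (?X x t \<omega>))" for x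
    using rho_pos by (intro int[of rho 0]) (simp add: less_imp_le)
  \<comment> \<open>The factor 2 leaves room for \<open>rho + f\<close> and \<open>rho - f\<close> with \<open>f\<close> 1-Lipschitz.\<close>
  have T_mono: "?T f x \<le> ?T f (x + 1)" if f: "mono f" "\<And>y. 0 \<le> f y" and le: "\<And>y. f y \<le> C + 2 * rho y" for f C x
  proof -
    have fin: "?P f x < \<infinity>" for x
    proof -
      have "\<bar>f y / 2\<bar> \<le> \<bar>C\<bar> / 2 + rho y" for y using f(2)[of y] le[of y] by linarith
      then have half: "integrable bd_noise (\<lambda>\<omega>. eval0 (\<lambda>y. f y / 2) (?X x t \<omega>))" by (rule int)
      have twice: "eval0 f z = 2 * eval0 (\<lambda>y. f y / 2) z" for z by (simp add: eval0_def split: option.split)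
      have "integrable bd_noise (\<lambda>\<omega>. eval0 f (?X x t \<omega>))"
        unfolding twice by (intro integrable_mult_right half)
      moreover have "norm (eval0 f z) = eval0 f z" for z using f(2) by (simp add: eval0_def split: option.split)
      ultimately show ?thesis by (simp add: integrable_iff_bounded nn_integral_eval0)
    qed
    have "?P f x \<le> ?P f (x + 1)"
      unfolding intertwining[of lam nu u, OF irr nonex u_pos f t] by simp
    then show ?thesis
      unfolding bd_semigroup_nonneg_eq[of f, OF f(2)] using fin[of "x + 1"] by (intro enn2real_mono) auto
  qed
  have T_rho: "ennreal (?T rho (x + 1) - ?T rho x) = ennreal (u x) * ?K x" for x
  proof -
    have "rho (y + 1) - rho y = u y" for y by (simp add: u_def)
    then have "(\<lambda>y. ennreal ((rho (y + 1) - rho y) / u y)) = (\<lambda>_. 1)" using u_pos by (simp add: less_imp_neq[symmetric])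
    then have eq: "?P rho (x + 1) = ?P rho x + ennreal (u x) * ?K x"
      using intertwining[of lam nu u, OF irr nonex u_pos rho_mono less_imp_le[OF rho_pos] t, of x]
          by (simp add: feynman_kac_eq_fk)
    have T: "?P rho y = ennreal (?T rho y)" for y
      using finite[of y] rho_pos by (simp add: bd_semigroup_nonneg_eq less_imp_le ennreal_enn2real_if)
    have "0 \<le> ?T rho x" using rho_pos by (simp add: bd_semigroup_nonneg_eq less_imp_le)
    then show ?thesis
      using eq unfolding T by (simp add: ennreal_minus[symmetric] ennreal_add_diff_cancel_left)
  qed
  have T_rho_mono: "?T rho x \<le> ?T rho (x + 1)" for x
    using rho_pos by (intro T_mono[of rho 0] rho_mono) (auto simp: less_imp_le)
  have quot: "ennreal (\<bar>?T rho (x + 1) - ?T rho x\<bar> / u x) = ?K x" for x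
  proof -
    have "ennreal (\<bar>?T rho (x + 1) - ?T rho x\<bar> / u x) = ennreal (u x) * ?K x / ennreal (u x)"
      using T_rho_mono[of x] u_pos[of x] by (simp add: T_rho[symmetric] divide_ennreal)
    also have "\<dots> = ?K x"
      unfolding mult.commute[of "ennreal (u x)"] using u_pos[of x] by (intro mult_divide_eq_ennreal) auto
    finally show ?thesis .
  qed
  show second: "lip_norm d (?T rho) = (SUP x. ?K x)" unfolding lip quot ..
  have contr: "\<bar>?T f (x + 1) - ?T f x\<bar> \<le> ?T rho (x + 1) - ?T rho x" if f: "lip_norm d f \<le> 1" for f x
  proof -
    have inc: "\<bar>f (y + 1) - f y\<bar> \<le> u y" for y
    proof -
      have "ennreal (\<bar>f (y + 1) - f y\<bar> / u y) \<le> ennreal 1"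
        using f unfolding lip by (auto simp: SUP_le_iff)
      then show ?thesis using u_pos[of y] by (simp add: pos_divide_le_eq)
    qed
    have f_le: "\<bar>f y - f 0\<bar> \<le> rho y - rho 0" for y
    proof (induction y)
      case (Suc y)
      then show ?case using inc[of y] by (simp add: u_def)
    qed simp
    define C where "C = \<bar>f 0\<bar>"
    have C: "\<bar>f y\<bar> \<le> C + rho y" for y using f_le[of y] rho_pos[of 0] by (simp add: C_def)
    have f_int: "integrable bd_noise (\<lambda>\<omega>. eval0 f (?X y t \<omega>))" for y by (rule int[OF C])
    have C_T: "?T (\<lambda>_. C) y = C" for y
      using one[of C y] by (simp add: bd_semigroup_nonneg_eq C_def)
    have C_int: "integrable bd_noise (\<lambda>\<omega>. eval0 (\<lambda>_. C) (?X y t \<omega>))" for y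
      by (rule int[of _ C]) (use rho_pos in \<open>auto simp: C_def less_imp_le\<close>)
    have lin: "?T (\<lambda>y. rho y + s * f y + C) y = ?T rho y + s * ?T f y + C" for s y
    proof -
      have "eval0 (\<lambda>y. rho y + s * f y + C) z = eval0 rho z + s * eval0 f z + eval0 (\<lambda>_. C) z" for z
        by (simp add: eval0_def split: option.split)
      then have "?T (\<lambda>y. rho y + s * f y + C) y = ?T rho y + s * ?T f y + ?T (\<lambda>_. C) y"
        unfolding bd_semigroup_def using rho_int f_int C_int by simp
      then show ?thesis by (simp add: C_T)
    qed
    have mono: "?T (\<lambda>y. rho y + s * f y + C) x \<le> ?T (\<lambda>y. rho y + s * f y + C) (x + 1)" if s: "\<bar>s\<bar> = 1" for s
    proof (rule T_mono)
      have s': "\<bar>s * r\<bar> = \<bar>r\<bar>" for r using s by (simp add: abs_mult)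
      show "mono (\<lambda>y. rho y + s * f y + C)"
      proof (rule incseq_SucI)
        fix y
        have "\<bar>s * f (y + 1) - s * f y\<bar> \<le> rho (y + 1) - rho y"
          using inc[of y] s'[of "f (y + 1) - f y"] by (simp add: u_def right_diff_distrib)
        then show "rho y + s * f y + C \<le> rho (Suc y) + s * f (Suc y) + C" by simp
      qed
      show "0 \<le> rho y + s * f y + C" for y using C[of y] s'[of "f y"] by linarith
      show "rho y + s * f y + C \<le> 2 * C + 2 * rho y" for y using C[of y] s'[of "f y"] by linarith
    qed
    from mono[of 1] mono[of "-1"] show ?thesis unfolding lin by simp
  qed
  show "lip_op_norm d ?T = lip_norm d (?T rho)"
  proof (rule antisym)
    show "lip_op_norm d ?T \<le> lip_norm d (?T rho)"
      unfolding lip_op_norm_def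
    proof (rule SUP_least)
      fix f assume "f \<in> {f. lip_norm d f \<le> 1}"
      then have f: "lip_norm d f \<le> 1" by simp
      show "lip_norm d (?T f) \<le> lip_norm d (?T rho)"
        unfolding lip
      proof (rule SUP_mono)
        fix x
        have "\<bar>?T f (x + 1) - ?T f x\<bar> / u x \<le> \<bar>?T rho (x + 1) - ?T rho x\<bar> / u x"
          using contr[OF f, of x] u_pos[of x] by (intro divide_right_mono) auto
        then show "\<exists>m\<in>UNIV. ennreal (\<bar>?T f (x + 1) - ?T f x\<bar> / u x) \<le> ennreal (\<bar>?T rho (m + 1) - ?T rho m\<bar> / u m)"
          by (intro bexI[of _ x] ennreal_leI) auto
      qed
    qed
    have "lip_norm d rho \<le> 1"
      unfolding lip using u_pos by (intro SUP_least) (simp add: u_def[symmetric, simplified] less_imp_neq[symmetric]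
          less_imp_le)
    then show "lip_norm d (?T rho) \<le> lip_op_norm d ?T"
      unfolding lip_op_norm_def by (intro SUP_upper) simp
  qed
qed

theorem corollary3p1:
  fixes lam nu rho u :: "nat \<Rightarrow> real" and d\<^sub>u :: "nat \<Rightarrow> nat \<Rightarrow> real"
  assumes irreducible: "bd_irreducible lam nu"
    and nonexplosive: "bd_nonexplosive lam nu"
    and rho_pos: "\<And>x. 0 < rho x"
    and u_def: "\<And>x. u x = rho (x + 1) - rho x"
    and u_pos: "\<And>x. 0 < u x"
    and d_def: "\<And>x y. d\<^sub>u x y = \<bar>rho x - rho y\<bar>"
    and rates_integrable: "\<And>t x. 0 \<le> t \<Longrightarrow>
      bd_semigroup_nn (mod_birth u lam) (mod_death u nu) t
        (\<lambda>y. ennreal (mod_birth u lam y + mod_death u nu y + \<bar>potential u lam nu y\<bar>)) x < \<infinity>"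
    and distance_integrable: "\<And>t x x0. 0 \<le> t \<Longrightarrow>
      summable (\<lambda>y. d\<^sub>u y x0 * bd_prob lam nu t x y)"
    and potential_bdd_below: "bdd_below (range (potential u lam nu))"
  shows "(\<forall>t\<ge>0.
            lip_op_norm d\<^sub>u (bd_semigroup lam nu t) = lip_norm d\<^sub>u (bd_semigroup lam nu t rho) \<and>
            lip_norm d\<^sub>u (bd_semigroup lam nu t rho) =
              (SUP x. feynman_kac (mod_birth u lam) (mod_death u nu) (potential u lam nu) t x)) \<and>
         is_wasserstein_curvature lam nu d\<^sub>u (INF y. potential u lam nu y)"
proof (intro conjI)
  let ?K = "feynman_kac (mod_birth u lam) (mod_death u nu) (potential u lam nu)"
  show norms: "\<forall>t\<ge>0. lip_op_norm d\<^sub>u (bd_semigroup lam nu t) = lip_norm d\<^sub>u (bd_semigroup lam nu t rho) \<and>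
            lip_norm d\<^sub>u (bd_semigroup lam nu t rho) = (SUP x. ?K t x)"
    using lip_norm_semigroup[of lam nu rho u d\<^sub>u, OF irreducible nonexplosive rho_pos u_def u_pos d_def distance_integrable]
    by blast
  show "is_wasserstein_curvature lam nu d\<^sub>u (INF y. potential u lam nu y)"
    unfolding is_wasserstein_curvature_def
  proof (intro conjI allI impI)
    show "lip_contraction lam nu d\<^sub>u (INF y. potential u lam nu y)"
      unfolding lip_contraction_def
    proof (intro allI impI)
      fix t :: real assume t: "0 \<le> t"
      have "?K t x \<le> ennreal (exp (- (INF y. potential u lam nu y) * t))" for x
        unfolding feynman_kac_eq_fk using t
        by (intro fk_one_le_exp cINF_lower potential_bdd_below) auto
      then show "lip_op_norm d\<^sub>u (bd_semigroup lam nu t) \<le> ennreal (exp (- (INF y. potential u lam nu y) * t))"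
        using norms t by (simp add: SUP_least)
    qed
  next
    fix \<sigma> assume \<sigma>: "lip_contraction lam nu d\<^sub>u \<sigma>"
    have "\<sigma> \<le> potential u lam nu x" for x
    proof (rule fk_one_decay_le_potential)
      fix t :: real assume t: "0 \<le> t"
      have "?K t x \<le> (SUP x. ?K t x)" by (rule SUP_upper) simp
      also have "\<dots> \<le> ennreal (exp (- \<sigma> * t))"
        using norms \<sigma> t unfolding lip_contraction_def by metis
      finally show "fk (mod_birth u lam) (mod_death u nu) (potential u lam nu) (\<lambda>_. 1) t x \<le> ennreal (exp (- \<sigma> * t))"
        by (simp add: feynman_kac_eq_fk)
    qed (use mod_birth_pos mod_death_nonneg mod_rate_pos irreducible nonexplosive u_pos in \<open>auto intro: less_imp_le\<close>)
    then show "\<sigma> \<le> (INF y. potential u lam nu y)" by (intro cINF_greatest) auto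
  qed
qed

end
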